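(* Let $k,n,p\in\mathbb{N}$ with $p$ prime, let $m\in\mathbb{N}$ and $\epsilon>0$. Any $(m,\epsilon)$-Kakeya set $S\subseteq(\mathbb{Z}/p^k\mathbb{Z})^n$ satisfies $$|S|\ \ge\ \epsilon\cdot\frac{m^n}{\bigl(2(k+\lceil\log_p(n)\rceil)\bigr)^n}.$$ Moreover, when $p>n$, every $(m,\epsilon)$-Kakeya set $S\subseteq(\mathbb{Z}/p^k\mathbb{Z})^n$ satisfies $$|S|\ \ge\ \epsilon\cdot\frac{m^n}{(k+1)^n}\,(1+n/p)^{-n}.$$
   Context: For $N=p_1^{k_1}\cdots p_r^{k_r}$ (distinct primes $p_i$), the projective space $\mathbb{P}(\mathbb{Z}/N\mathbb{Z})^{n-1}$ is the set of vectors $u\in(\mathbb{Z}/N\mathbb{Z})^n$ such that for every $i$, $u \bmod p_i^{k_i}$ has at least one unit coordinate, taken up to multiplication by units of $\mathbb{Z}/N\mathbb{Z}$; a fixed representative in $(\mathbb{Z}/N\mathbb{Z})^n$ is chosen for each class (its elements are called directions). A line in direction $u$ is a set $\{a+\lambda u:\lambda\in\mathbb{Z}/N\mathbb{Z}\}$ with $a\in(\mathbb{Z}/N\mathbb{Z})^n$. A line $L$ is $m$-rich with respect to $S\subseteq(\mathbb{Z}/N\mathbb{Z})^n$ if $|S\cap L|\ge m$. A set $S\subseteq(\mathbb{Z}/N\mathbb{Z})^n$ is $(m,\epsilon)$-Kakeya if for at least an $\epsilon$ fraction of directions $u\in\mathbb{P}(\mathbb{Z}/N\mathbb{Z})^{n-1}$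 there is a line in direction $u$ that is $m$-rich with respect to $S$. *)

theory Defs
  imports "HOL-Number_Theory.Number_Theory" Complex_Main
begin

abbreviation Zmod :: "nat \<Rightarrow> int ring" where
  "Zmod N \<equiv> residue_ring (int N)"

definition vecs :: "nat \<Rightarrow> nat \<Rightarrow> (nat \<Rightarrow> int) set" where
  "vecs N n = {..<n} \<rightarrow>\<^sub>E carrier (Zmod N)"

definition vadd :: "nat \<Rightarrow> nat \<Rightarrow> (nat \<Rightarrow> int) \<Rightarrow> (nat \<Rightarrow> int) \<Rightarrow> (nat \<Rightarrow> int)" where
  "vadd N n a b = (\<lambda>i\<in>{..<n}. a i \<oplus>\<^bsub>Zmod N\<^esub> b i)"

definition vscale :: "nat \<Rightarrow> nat \<Rightarrow> int \<Rightarrow> (nat \<Rightarrow> int) \<Rightarrow> (nat \<Rightarrow> int)" where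
  "vscale N n c u = (\<lambda>i\<in>{..<n}. c \<otimes>\<^bsub>Zmod N\<^esub> u i)"

(* For a prime factor q of N, q ^ multiplicity q N is the prime power p_i^{k_i} of the
   factorization of N. *)
definition proj_vecs :: "nat \<Rightarrow> nat \<Rightarrow> (nat \<Rightarrow> int) set" where
  "proj_vecs N n = {u \<in> vecs N n. \<forall>q \<in> prime_factors N. \<exists>j<n.
     u j mod int (q ^ multiplicity q N) \<in> Units (Zmod (q ^ multiplicity q N))}"

definition proj_rel :: "nat \<Rightarrow> nat \<Rightarrow> ((nat \<Rightarrow> int) \<times> (nat \<Rightarrow> int)) set" where
  "proj_rel N n = {(u, v). u \<in> proj_vecs N n \<and> v \<in> proj_vecs N n \<and>
     (\<exists>c \<in> Units (Zmod N). v = vscale N n c u)}"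

definition proj_space :: "nat \<Rightarrow> nat \<Rightarrow> (nat \<Rightarrow> int) set set" where
  "proj_space N n = proj_vecs N n // proj_rel N n"

(* D is a choice of one representative for each point of projective space; results are
   stated for an arbitrary such choice. *)
definition direction_set :: "nat \<Rightarrow> nat \<Rightarrow> (nat \<Rightarrow> int) set \<Rightarrow> bool" where
  "direction_set N n D \<longleftrightarrow> D \<subseteq> proj_vecs N n \<and> (\<forall>C \<in> proj_space N n. \<exists>!u. u \<in> C \<inter> D)"

definition line :: "nat \<Rightarrow> nat \<Rightarrow> (nat \<Rightarrow> int) \<Rightarrow> (nat \<Rightarrow> int) \<Rightarrow> (nat \<Rightarrow> int) set" where
  "line N n a u = {vadd N n a (vscale N n c u) | c. c \<in> carrier (Zmod N)}"

definition rich :: "nat \<Rightarrow> 'a set \<Rightarrow> 'a set \<Rightarrow> bool" where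
  "rich m S L \<longleftrightarrow> card (S \<inter> L) \<ge> m"

definition kakeya ::
  "nat \<Rightarrow> nat \<Rightarrow> (nat \<Rightarrow> int) set \<Rightarrow> nat \<Rightarrow> real \<Rightarrow> (nat \<Rightarrow> int) set \<Rightarrow> bool" where
  "kakeya N n D m \<epsilon> S \<longleftrightarrow> S \<subseteq> vecs N n \<and>
     real (card {u \<in> D. \<exists>a \<in> vecs N n. rich m S (line N n a u)}) \<ge> \<epsilon> * real (card D)"

end

(* Arsovski's method with multiplicities. Let q = p^k, let zeta be a primitive q-th root of unity, and
   embed (Z/q)^n into C^n by x |-> (zeta^(x_1), ..., zeta^(x_n)). For a polynomial f and an m-rich line
   {a + l u}, the one-variable polynomial f(zeta^a z^u) modulo the product of (z - zeta^l)^N over the m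
   parameters l of points in S depends only on the jets of f of order N at S. Its coefficients lie in
   Z[zeta] if those of f do, and modulo the prime 1 - zeta they become those of f(z^u) modulo
   (p, (z-1)^(mN)). As the rank cannot grow under reduction, |S| times the number of multi-indices of
   order less than N bounds the F_p-rank of the truncated polynomials z^<u,v> with u over rich directions.

   If u is unrestricted, this rank is estimated by a q-analogue of Newton interpolation: the product of
   z^t - z^j over j < t has order at most L t at z = 1 whenever t < p^L. Averaging a basis of rows over
   GL_n(Z/p^L) passes to an epsilon fraction of the directions. With N = p^l and L = k + l this gives
   |S| >= epsilon (m N / (L (N + n)))^n; the two bounds are l = ceil(log_p n) and l = 1. *)

theory Submission
  imports Defs "HOL-Combinatorics.Permutations" "HOL-Computational_Algebra.Polynomial"
    "HOL-Algebra.Exponent"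
begin

section \<open>Cyclotomic integers at a prime power\<close>

definition ieval :: "complex \<Rightarrow> int poly \<Rightarrow> complex" where
  "ieval z Q = poly (map_poly of_int Q) z"

lemma ieval_pCons [simp]: "ieval z (pCons a Q) = of_int a + z * ieval z Q"
  by (cases "a = 0 \<and> Q = 0") (auto simp: ieval_def map_poly_pCons)

lemma ieval_0 [simp]: "ieval z 0 = 0"
  by (simp add: ieval_def)

lemma ieval_1 [simp]: "ieval z 1 = 1"
  by (simp add: one_pCons)

lemma ieval_add [simp]: "ieval z (P + Q) = ieval z P + ieval z Q"
  by (induction P Q rule: poly_induct2) (auto simp: algebra_simps)

lemma ieval_smult [simp]: "ieval z (smult a P) = of_int a * ieval z P"
  by (induction P) (auto simp: algebra_simps)

lemma ieval_uminus [simp]: "ieval z (- P) = - ieval z P"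
  using ieval_smult[of z "-1" P] by simp

lemma ieval_mult [simp]: "ieval z (P * Q) = ieval z P * ieval z Q"
  by (induction P) (auto simp: algebra_simps)

lemma ieval_sum: "ieval z (\<Sum>i\<in>A. f i) = (\<Sum>i\<in>A. ieval z (f i))"
  by (induction A rule: infinite_finite_induct) auto

lemma ieval_prod: "ieval z (\<Prod>i\<in>A. f i) = (\<Prod>i\<in>A. ieval z (f i))"
  by (induction A rule: infinite_finite_induct) auto

lemma ieval_monom [simp]: "ieval z (monom a k) = of_int a * z ^ k"
  by (induction k) (auto simp: monom_0 monom_Suc)

lemma ieval_pcompose: "ieval z (pcompose Q P) = ieval (ieval z P) Q"
  by (induction Q) (auto simp: pcompose_pCons)

lemma degree_map_poly_of_int: "degree (map_poly (of_int :: int \<Rightarrow> complex) Q) = degree Q"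
  by (rule degree_map_poly) auto

lemma card_ieval_roots_bound:
  assumes "Q \<noteq> 0"
  shows "finite {z. ieval z Q = 0}" and "card {z. ieval z Q = 0} \<le> degree Q"
proof -
  have nz: "map_poly (of_int :: int \<Rightarrow> complex) Q \<noteq> 0"
    using assms by (simp add: map_poly_eq_0_iff)
  show "finite {z. ieval z Q = 0}"
    unfolding ieval_def using nz by (rule poly_roots_finite)
  show "card {z. ieval z Q = 0} \<le> degree Q"
    unfolding ieval_def using card_poly_roots_bound[OF nz] by (simp add: degree_map_poly_of_int)
qed

definition root_unity :: "nat \<Rightarrow> complex" where
  "root_unity q = cis (2 * pi / real q)"

lemma root_unity_power: "root_unity q ^ e = cis (2 * pi * real e / real q)"
  by (simp add: root_unity_def DeMoivre field_simps)

lemma root_unity_nonzero [simp]: "root_unity q \<noteq> 0"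
  by (simp add: root_unity_def)

lemma root_unity_power_self: "q > 0 \<Longrightarrow> root_unity q ^ q = 1"
  by (simp add: root_unity_power)

lemma root_unity_power_cong:
  assumes "q > 0" "[a = b] (mod q)"
  shows "root_unity q ^ a = root_unity q ^ b"
proof -
  have "root_unity q ^ c = root_unity q ^ (c mod q)" for c
  proof -
    have "root_unity q ^ c = root_unity q ^ (q * (c div q) + c mod q)" by simp
    also have "\<dots> = root_unity q ^ (c mod q)"
      using assms(1) by (simp only: power_add power_mult root_unity_power_self) simp
    finally show ?thesis .
  qed
  thus ?thesis using assms(2) unfolding cong_def by metis
qed

lemma root_unity_power_inj:
  assumes "q > 0" "a < q" "b < q" "root_unity q ^ a = root_unity q ^ b"
  shows "a = b"
proof -
  have "inj_on (\<lambda>k. cis (2 * pi * real k / real q)) {..<q}"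
    using bij_betw_roots_unity[OF assms(1)] by (rule bij_betw_imp_inj_on)
  thus ?thesis using assms(2-4) by (auto simp: root_unity_power inj_on_def)
qed

(* Multiplying the Galois conjugates Q(t^c) gives an integer polynomial that vanishes at all
   primitive roots of unity, hence is divisible by the cyclotomic polynomial, whose value at 1 is p. *)
lemma prime_dvd_poly_1_if_ieval_root_unity_0:
  fixes Q :: "int poly"
  assumes p: "prime (p::nat)" and k: "k \<ge> 1" and zero: "ieval (root_unity (p ^ k)) Q = 0"
  shows "int p dvd poly Q 1"
proof -
  define q where "q = p ^ k"
  define C where "C = {c. c < q \<and> coprime c q}"
  define R where "R = (\<Prod>c\<in>C. pcompose Q (monom 1 c))"
  define \<Phi> :: "int poly" where "\<Phi> = (\<Sum>i<p. monom 1 (i * p ^ (k - 1)))"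
  define z where "z = root_unity q"
  have p1: "p > 1" using p prime_gt_1_nat by blast
  have q1: "q > 1" using one_less_power[OF p1, of k] k by (simp add: q_def)
  have qp: "q = p * p ^ (k - 1)" using k by (simp add: q_def power_eq_if)
  have finC: "finite C" by (auto simp: C_def)
  have Rz: "ieval (z ^ b) R = 0" if b: "b \<in> C" for b
  proof -
    have "coprime b q" using b by (simp add: C_def)
    from cong_solve_coprime_nat[OF this] obtain c where c: "[b * c = 1] (mod q)" by auto
    have c': "[b * (c mod q) = 1] (mod q)" using c unfolding cong_def by (simp only: mod_mult_right_eq)
    have "coprime (b * (c mod q)) q" using cong_imp_coprime[OF cong_sym[OF c']] by simp
    hence cop: "coprime (c mod q) q" by simp
    have cC: "c mod q \<in> C" using cop q1 by (simp add: C_def)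
    have "z ^ (b * (c mod q)) = z ^ 1"
      unfolding z_def using c' q1 by (intro root_unity_power_cong) auto
    hence "ieval (z ^ b) (pcompose Q (monom 1 (c mod q))) = 0"
      using zero by (simp add: ieval_pcompose power_mult z_def q_def)
    thus ?thesis using cC finC unfolding R_def ieval_prod by (meson prod_zero)
  qed
  have Phiz: "ieval (z ^ b) \<Phi> = 0" if b: "b \<in> C" for b
  proof -
    define \<omega> where "\<omega> = (z ^ b) ^ (p ^ (k - 1))"
    have om: "\<omega> = z ^ (b * p ^ (k - 1))" by (simp add: \<omega>_def power_mult)
    have "\<omega> \<noteq> 1"
    proof
      assume "\<omega> = 1"
      have "z ^ ((b * p ^ (k - 1)) mod q) = z ^ 0"
        using \<open>\<omega> = 1\<close> q1 root_unity_power_cong[of q "(b * p ^ (k - 1)) mod q" "b * p ^ (k - 1)"]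
        unfolding om z_def by (simp add: cong_def)
      hence "(b * p ^ (k - 1)) mod q = 0"
        unfolding z_def using q1 by (intro root_unity_power_inj[of q]) auto
      hence "p * p ^ (k - 1) dvd b * p ^ (k - 1)" using qp by auto
      hence "p dvd b" using p1 by (simp add: mult.commute)
      thus False using b k p1 unfolding C_def q_def
        using coprime_common_divisor_nat[of b p p] by simp
    qed
    moreover have "\<omega> ^ p = 1"
    proof -
      have "\<omega> ^ p = z ^ (b * p ^ (k - 1) * p)" by (simp only: om power_mult)
      also have "b * p ^ (k - 1) * p = q * b" by (subst qp) (simp only: ac_simps)
      also have "z ^ (q * b) = (z ^ q) ^ b" by (simp only: power_mult)
      finally have "\<omega> ^ p = (z ^ q) ^ b" .
      thus ?thesis using q1 by (simp add: z_def root_unity_power_self)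
    qed
    moreover have "ieval (z ^ b) \<Phi> = (\<Sum>i<p. \<omega> ^ i)"
    proof -
      have "ieval (z ^ b) \<Phi> = (\<Sum>i<p. (z ^ b) ^ (i * p ^ (k - 1)))"
        by (simp add: \<Phi>_def ieval_sum)
      also have "\<dots> = (\<Sum>i<p. \<omega> ^ i)"
        by (intro sum.cong refl) (simp only: om power_mult[symmetric] mult.commute mult.left_commute)
      finally show ?thesis .
    qed
    ultimately show ?thesis by (simp add: geometric_sum)
  qed
  have cPhi: "coeff \<Phi> j = (\<Sum>i<p. if i * p ^ (k - 1) = j then 1 else 0)" for j
    by (simp add: \<Phi>_def coeff_sum)
  have top: "coeff \<Phi> ((p - 1) * p ^ (k - 1)) = 1"
  proof -
    have "coeff \<Phi> ((p - 1) * p ^ (k - 1)) = (\<Sum>i<p. if i = p - 1 then 1 else 0)"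
      unfolding cPhi using p1 by (intro sum.cong) auto
    also have "\<dots> = 1" using p1 by simp
    finally show ?thesis .
  qed
  have degPhi: "degree \<Phi> = (p - 1) * p ^ (k - 1)"
  proof (rule antisym)
    show "degree \<Phi> \<le> (p - 1) * p ^ (k - 1)"
    proof (rule degree_le, intro allI impI)
      fix j assume j: "(p - 1) * p ^ (k - 1) < j"
      have "i * p ^ (k - 1) \<noteq> j" if "i < p" for i
      proof -
        have "i \<le> p - 1" using that by simp
        from mult_le_mono1[OF this, of "p ^ (k - 1)"] j show ?thesis by linarith
      qed
      thus "coeff \<Phi> j = 0" unfolding cPhi by (intro sum.neutral) auto
    qed
    show "(p - 1) * p ^ (k - 1) \<le> degree \<Phi>" using top by (intro le_degree) simp
  qed
  have lcPhi: "lead_coeff \<Phi> = 1" unfolding degPhi by (rule top)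
  hence Phi0: "\<Phi> \<noteq> 0" by auto
  obtain A B where AB: "pseudo_divmod R \<Phi> = (A, B)" by fastforce
  have RAB: "R = \<Phi> * A + B" and degB: "B = 0 \<or> degree B < degree \<Phi>"
    using pseudo_divmod[OF Phi0 AB] lcPhi by simp_all
  have "B = 0"
  proof (rule ccontr)
    assume B: "B \<noteq> 0"
    have "inj_on (\<lambda>b. z ^ b) C"
      unfolding z_def by (rule inj_onI, rule root_unity_power_inj[of q]) (use q1 in \<open>auto simp: C_def\<close>)
    hence "card C = card ((\<lambda>b. z ^ b) ` C)" by (simp add: card_image)
    also have "\<dots> \<le> card {x. ieval x B = 0}"
    proof (rule card_mono)
      show "finite {x. ieval x B = 0}" using B by (rule card_ieval_roots_bound)
      show "(\<lambda>b. z ^ b) ` C \<subseteq> {x. ieval x B = 0}"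
        using Rz Phiz RAB by auto
    qed
    also have "\<dots> \<le> degree B" using B by (rule card_ieval_roots_bound)
    also have "\<dots> < degree \<Phi>" using degB B by simp
    finally have "card C < (p - 1) * p ^ (k - 1)" using degPhi by simp
    moreover have "C = totatives q"
    proof -
      have "c \<in> C \<longleftrightarrow> c \<in> totatives q" for c
      proof -
        have "c \<noteq> q" if "coprime c q" using that q1 by auto
        moreover have "c \<noteq> 0" if "coprime c q" using that q1 by (cases "c = 0") auto
        ultimately show ?thesis unfolding C_def totatives_def by fastforce
      qed
      thus ?thesis by blast
    qed
    moreover have "card (totatives q) = p ^ (k - 1) * (p - 1)"
      using totient_prime_power[OF p, of k] k by (simp add: totient_def q_def)
    ultimately show False by (simp add: mult.commute)
  qed
  hence "poly R 1 = poly \<Phi> 1 * poly A 1" using RAB by simp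
  also have "poly \<Phi> 1 = int p" by (simp add: \<Phi>_def poly_sum poly_monom)
  finally have "int p dvd poly R 1" by simp
  also have "poly R 1 = poly Q 1 ^ card C"
    by (simp add: R_def poly_prod poly_pcompose poly_monom)
  finally show ?thesis using p prime_dvd_power by (metis prime_int_nat_transfer prime_nat_int_transfer)
qed

section \<open>Linear independence modulo a prime\<close>

lemma functional_in_span_if_kernel_le:
  fixes \<phi> :: "'i \<Rightarrow> 'v \<Rightarrow> 'k :: field"
  assumes "finite I"
    and "\<And>f. (\<And>i. i \<in> I \<Longrightarrow> (\<Sum>v\<in>V. f v * \<phi> i v) = 0) \<Longrightarrow> (\<Sum>v\<in>V. f v * \<psi> v) = 0"
    and "finite V"
  shows "\<exists>\<beta>. \<forall>v\<in>V. \<psi> v = (\<Sum>i\<in>I. \<beta> i * \<phi> i v)"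
  using assms(1,2)
proof (induction I arbitrary: \<psi> rule: finite_induct)
  case empty
  have "\<psi> w = 0" if "w \<in> V" for w
  proof -
    have "(\<Sum>v\<in>V. (if v = w then 1 else 0) * \<psi> v) = 0" by (rule empty) auto
    also have "(\<Sum>v\<in>V. (if v = w then 1 else 0) * \<psi> v) = (\<Sum>v\<in>V. if v = w then \<psi> v else 0)"
      by (intro sum.cong) auto
    finally show ?thesis using that assms(3) by simp
  qed
  thus ?case by simp
next
  case (insert i0 I)
  define P where "P = (\<lambda>f g :: 'v \<Rightarrow> 'k. \<Sum>v\<in>V. f v * g v)"
  have P_lin: "P (\<lambda>v. f v - a * g v) h = P f h - a * P g h"
    "P h (\<lambda>v. f v - a * g v) = P h f - a * P h g" for f g h a
    unfolding P_def by (simp_all add: algebra_simps sum_subtractf sum_distrib_left)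
  have ker: "P f \<psi> = 0" if "\<And>i. i \<in> insert i0 I \<Longrightarrow> P f (\<phi> i) = 0" for f
    using insert.prems[of f] that by (simp add: P_def)
  show ?case
  proof (cases "\<forall>f. (\<forall>i\<in>I. P f (\<phi> i) = 0) \<longrightarrow> P f (\<phi> i0) = 0")
    case True
    have "\<exists>\<beta>. \<forall>v\<in>V. \<psi> v = (\<Sum>i\<in>I. \<beta> i * \<phi> i v)"
    proof (rule insert.IH)
      fix f assume "\<And>i. i \<in> I \<Longrightarrow> (\<Sum>v\<in>V. f v * \<phi> i v) = 0"
      thus "(\<Sum>v\<in>V. f v * \<psi> v) = 0" using ker[of f] True by (auto simp: P_def)
    qed
    then obtain \<beta> where \<beta>: "\<forall>v\<in>V. \<psi> v = (\<Sum>i\<in>I. \<beta> i * \<phi> i v)" by blast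
    show ?thesis
    proof (intro exI ballI)
      fix v assume "v \<in> V"
      have "(\<Sum>i\<in>I. (\<beta>(i0 := 0)) i * \<phi> i v) = (\<Sum>i\<in>I. \<beta> i * \<phi> i v)"
        using insert.hyps by (intro sum.cong) auto
      thus "\<psi> v = (\<Sum>i\<in>insert i0 I. (\<beta>(i0 := 0)) i * \<phi> i v)"
        using \<beta> \<open>v \<in> V\<close> insert.hyps by simp
    qed
  next
    case False
    then obtain x where x: "\<forall>i\<in>I. P x (\<phi> i) = 0" "P x (\<phi> i0) \<noteq> 0" by blast
    define a where "a = P x \<psi> / P x (\<phi> i0)"
    have "\<exists>\<beta>. \<forall>v\<in>V. \<psi> v - a * \<phi> i0 v = (\<Sum>i\<in>I. \<beta> i * \<phi> i v)"
    proof (rule insert.IH)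
      fix f assume "\<And>i. i \<in> I \<Longrightarrow> (\<Sum>v\<in>V. f v * \<phi> i v) = 0"
      hence f: "\<forall>i\<in>I. P f (\<phi> i) = 0" by (simp add: P_def)
      define d where "d = P f (\<phi> i0) / P x (\<phi> i0)"
      have "P (\<lambda>v. f v - d * x v) \<psi> = 0"
      proof (intro ker)
        fix i assume "i \<in> insert i0 I"
        have "P (\<lambda>v. f v - d * x v) (\<phi> i) = P f (\<phi> i) - d * P x (\<phi> i)" by (rule P_lin(1))
        thus "P (\<lambda>v. f v - d * x v) (\<phi> i) = 0"
          using f x \<open>i \<in> insert i0 I\<close> by (auto simp: d_def)
      qed
      moreover have "P (\<lambda>v. f v - d * x v) \<psi> = P f \<psi> - d * P x \<psi>"
        "P f (\<lambda>v. \<psi> v - a * \<phi> i0 v) = P f \<psi> - a * P f (\<phi> i0)" by (rule P_lin)+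
      ultimately have "P f (\<lambda>v. \<psi> v - a * \<phi> i0 v) = 0"
        using x(2) by (simp add: a_def d_def field_simps)
      thus "(\<Sum>v\<in>V. f v * (\<psi> v - a * \<phi> i0 v)) = 0" by (simp add: P_def)
    qed
    then obtain \<beta> where \<beta>: "\<forall>v\<in>V. \<psi> v - a * \<phi> i0 v = (\<Sum>i\<in>I. \<beta> i * \<phi> i v)" by blast
    show ?thesis
    proof (intro exI ballI)
      fix v assume "v \<in> V"
      have "(\<Sum>i\<in>I. (\<beta>(i0 := a)) i * \<phi> i v) = (\<Sum>i\<in>I. \<beta> i * \<phi> i v)"
        using insert.hyps by (intro sum.cong) auto
      thus "\<psi> v = (\<Sum>i\<in>insert i0 I. (\<beta>(i0 := a)) i * \<phi> i v)"
        using \<beta> \<open>v \<in> V\<close> insert.hyps by (simp add: algebra_simps)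
    qed
  qed
qed

lemma underdetermined_system:
  fixes \<beta> :: "'j \<Rightarrow> 'i \<Rightarrow> 'k :: field"
  assumes "finite I" "finite J" "card I < card J"
  shows "\<exists>\<mu>. (\<exists>r\<in>J. \<mu> r \<noteq> 0) \<and> (\<forall>i\<in>I. (\<Sum>r\<in>J. \<mu> r * \<beta> r i) = 0)"
  using assms
proof (induction I arbitrary: J \<beta> rule: finite_induct)
  case empty
  hence "J \<noteq> {}" by auto
  thus ?case by (intro exI[of _ "\<lambda>_. 1"]) auto
next
  case (insert i0 I)
  show ?case
  proof (cases "\<forall>r\<in>J. \<beta> r i0 = 0")
    case True
    have "card I < card J" using insert by simp
    from insert.IH[OF insert.prems(1) this, of \<beta>] True show ?thesis by auto
  next
    case False
    then obtain r0 where r0: "r0 \<in> J" "\<beta> r0 i0 \<noteq> 0" by blast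
    have J: "J = insert r0 (J - {r0})" using r0 by blast
    have fin: "finite (J - {r0})" using insert.prems by simp
    have "card I < card (J - {r0})" using insert r0 by simp
    from insert.IH[OF fin this, of "\<lambda>r i. \<beta> r i - \<beta> r i0 / \<beta> r0 i0 * \<beta> r0 i"]
    obtain \<mu> r1 where r1: "r1 \<in> J - {r0}" "\<mu> r1 \<noteq> 0"
      and \<mu>: "\<And>i. i \<in> I \<Longrightarrow> (\<Sum>r\<in>J - {r0}. \<mu> r * (\<beta> r i - \<beta> r i0 / \<beta> r0 i0 * \<beta> r0 i)) = 0"
      by blast
    define s where "s = (\<Sum>r\<in>J - {r0}. \<mu> r * \<beta> r i0)"
    define \<nu> where "\<nu> = \<mu>(r0 := - s / \<beta> r0 i0)"
    have sum: "(\<Sum>r\<in>J. \<nu> r * \<beta> r i) = (\<Sum>r\<in>J - {r0}. \<mu> r * \<beta> r i) - s / \<beta> r0 i0 * \<beta> r0 i" for i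
      using fin by (subst J, subst sum.insert) (auto simp: \<nu>_def)
    have "(\<Sum>r\<in>J. \<nu> r * \<beta> r i) = 0" if "i \<in> insert i0 I" for i
    proof (cases "i = i0")
      case True
      thus ?thesis using r0 by (simp add: sum s_def)
    next
      case False
      hence "i \<in> I" using that by simp
      have "(\<Sum>r\<in>J - {r0}. \<mu> r * \<beta> r i) - s / \<beta> r0 i0 * \<beta> r0 i
        = (\<Sum>r\<in>J - {r0}. \<mu> r * (\<beta> r i - \<beta> r i0 / \<beta> r0 i0 * \<beta> r0 i))"
        unfolding s_def sum_divide_distrib sum_distrib_right sum_subtractf[symmetric]
        by (intro sum.cong) (auto simp: algebra_simps)
      thus ?thesis using \<mu>[OF \<open>i \<in> I\<close>] sum by simp
    qed
    moreover have "\<exists>r\<in>J. \<nu> r \<noteq> 0" using r1 by (auto simp: \<nu>_def intro!: bexI[of _ r1])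
    ultimately show ?thesis by blast
  qed
qed

definition indep_mod :: "nat \<Rightarrow> 'v set \<Rightarrow> ('r \<Rightarrow> 'v \<Rightarrow> int) \<Rightarrow> 'r set \<Rightarrow> bool" where
  "indep_mod p V b J \<longleftrightarrow>
     (\<forall>l. (\<forall>v\<in>V. int p dvd (\<Sum>r\<in>J. l r * b r v)) \<longrightarrow> (\<forall>r\<in>J. int p dvd l r))"

lemma indep_mod_subset:
  assumes "indep_mod p V b J" "finite J" "J' \<subseteq> J"
  shows "indep_mod p V b J'"
  unfolding indep_mod_def
proof (intro allI impI ballI)
  fix l r assume l: "\<forall>v\<in>V. int p dvd (\<Sum>r\<in>J'. l r * b r v)" and r: "r \<in> J'"
  define l' where "l' = (\<lambda>r. if r \<in> J' then l r else 0)"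
  have "(\<Sum>r\<in>J. l' r * b r v) = (\<Sum>r\<in>J'. l r * b r v)" for v
    using assms by (intro sum.mono_neutral_cong_right) (auto simp: l'_def)
  hence "\<forall>r\<in>J. int p dvd l' r" using assms(1) l unfolding indep_mod_def by simp
  hence "int p dvd l' r" using r assms(3) by blast
  thus "int p dvd l r" using r by (simp add: l'_def)
qed

lemma indep_mod_spanning_subset:
  assumes E: "finite E" and p: "prime p"
  obtains J where "J \<subseteq> E" "indep_mod p V b J"
    and "\<forall>e\<in>E. \<exists>s l. \<not> int p dvd s \<and> (\<forall>v\<in>V. int p dvd (s * b e v + (\<Sum>r\<in>J. l r * b r v)))"
proof -
  have p1: "\<not> int p dvd 1" using p by auto
  define Js where "Js = {J. J \<subseteq> E \<and> indep_mod p V b J}"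
  have "Js \<noteq> {}" by (auto simp: Js_def indep_mod_def)
  moreover have "finite Js" using E by (auto simp: Js_def)
  ultimately have "Max (card ` Js) \<in> card ` Js" and le: "\<And>J. J \<in> Js \<Longrightarrow> card J \<le> Max (card ` Js)"
    by (auto intro!: Max_in Max_ge)
  then obtain J where J: "J \<in> Js" and max: "\<And>J'. J' \<in> Js \<Longrightarrow> card J' \<le> card J" by force
  have finJ: "finite J" using J E finite_subset by (auto simp: Js_def)
  show thesis
  proof (rule that)
    show "J \<subseteq> E" "indep_mod p V b J" using J by (auto simp: Js_def)
    show "\<forall>e\<in>E. \<exists>s l. \<not> int p dvd s \<and> (\<forall>v\<in>V. int p dvd (s * b e v + (\<Sum>r\<in>J. l r * b r v)))"
    proof
      fix e assume e: "e \<in> E"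
      show "\<exists>s l. \<not> int p dvd s \<and> (\<forall>v\<in>V. int p dvd (s * b e v + (\<Sum>r\<in>J. l r * b r v)))"
      proof (cases "e \<in> J")
        case True
        have "(\<Sum>r\<in>J. (if r = e then - 1 else 0) * b r v) = (\<Sum>r\<in>J. if r = e then - b r v else 0)" for v
          by (intro sum.cong) auto
        hence "1 * b e v + (\<Sum>r\<in>J. (if r = e then - 1 else 0) * b r v) = 0" for v
          using True finJ by simp
        thus ?thesis using p1 by (metis dvd_0_right)
      next
        case False
        have "insert e J \<notin> Js" using max[of "insert e J"] False finJ by auto
        hence "\<not> indep_mod p V b (insert e J)" using J e by (auto simp: Js_def)
        then obtain l where l: "\<forall>v\<in>V. int p dvd (\<Sum>r\<in>insert e J. l r * b r v)"
          and nl: "\<exists>r\<in>insert e J. \<not> int p dvd l r" by (auto simp: indep_mod_def)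
        have sum: "(\<Sum>r\<in>insert e J. l r * b r v) = l e * b e v + (\<Sum>r\<in>J. l r * b r v)" for v
          using False finJ by simp
        have "\<not> int p dvd l e"
        proof
          assume le: "int p dvd l e"
          have "\<forall>v\<in>V. int p dvd (\<Sum>r\<in>J. l r * b r v)"
          proof
            fix v assume "v \<in> V"
            hence "int p dvd l e * b e v + (\<Sum>r\<in>J. l r * b r v)" using l sum by simp
            moreover have "int p dvd l e * b e v" using le by (rule dvd_mult2)
            ultimately show "int p dvd (\<Sum>r\<in>J. l r * b r v)" using dvd_add_right_iff by blast
          qed
          hence "\<forall>r\<in>J. int p dvd l r" using J by (auto simp: Js_def indep_mod_def)
          thus False using nl le by auto
        qed
        thus ?thesis using l sum by auto
      qed
    qed
  qed
qed

lemma indep_mod_large_subset: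
  fixes b :: "'r \<Rightarrow> 'v \<Rightarrow> int"
  assumes E: "finite E" and p: "prime p" and T: "finite T" "T \<subseteq> V"
    and detect: "\<And>\<delta>. (\<And>e. e \<in> E \<Longrightarrow> int p dvd (\<Sum>v\<in>T. \<delta> v * b e v)) \<Longrightarrow> (\<And>v. v \<in> T \<Longrightarrow> int p dvd \<delta> v)"
  obtains J where "J \<subseteq> E" "indep_mod p V b J" "card T \<le> card J"
proof -
  obtain J where J: "J \<subseteq> E" "indep_mod p V b J"
    and span: "\<forall>e\<in>E. \<exists>s l. \<not> int p dvd s \<and> (\<forall>v\<in>V. int p dvd (s * b e v + (\<Sum>r\<in>J. l r * b r v)))"
    by (rule indep_mod_spanning_subset[OF E p, of V b])
  have finJ: "finite J" using J E finite_subset by blast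
  have p1: "p > 1" using p prime_gt_1_nat by blast
  have pint: "prime (int p)" using p by simp
  define A where "A = (T \<rightarrow>\<^sub>E {0..<int p})"
  define h where "h = (\<lambda>f :: 'v \<Rightarrow> int. \<lambda>r\<in>J. (\<Sum>v\<in>T. f v * b r v) mod int p)"
  have "inj_on h A"
  proof (rule inj_onI)
    fix f g assume f: "f \<in> A" and g: "g \<in> A" and fg: "h f = h g"
    define \<delta> where "\<delta> = (\<lambda>v. f v - g v)"
    have J0: "int p dvd (\<Sum>v\<in>T. \<delta> v * b r v)" if "r \<in> J" for r
    proof -
      have "(\<Sum>v\<in>T. f v * b r v) mod int p = (\<Sum>v\<in>T. g v * b r v) mod int p"
        using fun_cong[OF fg, of r] that by (simp add: h_def)
      hence "int p dvd (\<Sum>v\<in>T. f v * b r v) - (\<Sum>v\<in>T. g v * b r v)" by (simp add: mod_eq_dvd_iff)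
      thus ?thesis by (simp add: \<delta>_def algebra_simps sum_subtractf)
    qed
    have "int p dvd (\<Sum>v\<in>T. \<delta> v * b e v)" if e: "e \<in> E" for e
    proof -
      obtain s l where s: "\<not> int p dvd s"
        and sl: "\<And>v. v \<in> V \<Longrightarrow> int p dvd (s * b e v + (\<Sum>r\<in>J. l r * b r v))"
        using span e by blast
      have "int p dvd (\<Sum>v\<in>T. \<delta> v * (s * b e v + (\<Sum>r\<in>J. l r * b r v)))"
        using sl T by (intro dvd_sum dvd_mult) auto
      also have "(\<Sum>v\<in>T. \<delta> v * (s * b e v + (\<Sum>r\<in>J. l r * b r v)))
        = s * (\<Sum>v\<in>T. \<delta> v * b e v) + (\<Sum>v\<in>T. \<Sum>r\<in>J. l r * (\<delta> v * b r v))"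
        by (simp add: algebra_simps sum.distrib sum_distrib_left)
      also have "(\<Sum>v\<in>T. \<Sum>r\<in>J. l r * (\<delta> v * b r v)) = (\<Sum>r\<in>J. l r * (\<Sum>v\<in>T. \<delta> v * b r v))"
        by (subst sum.swap) (simp add: sum_distrib_left)
      finally have "int p dvd s * (\<Sum>v\<in>T. \<delta> v * b e v) + (\<Sum>r\<in>J. l r * (\<Sum>v\<in>T. \<delta> v * b r v))" .
      moreover have "int p dvd (\<Sum>r\<in>J. l r * (\<Sum>v\<in>T. \<delta> v * b r v))"
      proof (rule dvd_sum)
        fix r assume "r \<in> J"
        thus "int p dvd l r * (\<Sum>v\<in>T. \<delta> v * b r v)" using J0 by (intro dvd_mult)
      qed
      ultimately have "int p dvd s * (\<Sum>v\<in>T. \<delta> v * b e v)" by (simp add: dvd_add_left_iff)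
      thus ?thesis using s pint by (simp add: prime_dvd_mult_iff)
    qed
    hence d: "int p dvd \<delta> v" if "v \<in> T" for v using detect that by blast
    show "f = g"
    proof (rule PiE_ext[OF f[unfolded A_def] g[unfolded A_def]])
      fix v assume v: "v \<in> T"
      have "f v mod int p = g v mod int p" using d[OF v] by (simp add: \<delta>_def mod_eq_dvd_iff)
      moreover have "f v \<in> {0..<int p}" "g v \<in> {0..<int p}"
        using f g v unfolding A_def by (auto simp: PiE_iff)
      ultimately show "f v = g v" by simp
    qed
  qed
  moreover have "h ` A \<subseteq> (J \<rightarrow>\<^sub>E {0..<int p})"
    using p1 by (auto simp: h_def)
  ultimately have "card A \<le> card (J \<rightarrow>\<^sub>E {0..<int p})"
    using finJ by (intro card_inj_on_le) (auto intro!: finite_PiE)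
  hence "p ^ card T \<le> p ^ card J"
    using finJ T by (simp add: A_def card_PiE)
  hence "card T \<le> card J" using p1 by simp
  thus thesis using that J by blast
qed

(* Fraction-free Gaussian elimination: the pivots are units at the prime, so they are nonzero. *)
lemma independent_if_indep_mod:
  fixes c :: "'r \<Rightarrow> 'v \<Rightarrow> 'k :: field" and rel :: "'k \<Rightarrow> int \<Rightarrow> bool"
  assumes rel_0: "\<And>a. rel 0 a \<Longrightarrow> int p dvd a"
    and rel_mult: "\<And>x y a b. rel x a \<Longrightarrow> rel y b \<Longrightarrow> rel (x * y) (a * b)"
    and rel_diff: "\<And>x y a b. rel x a \<Longrightarrow> rel y b \<Longrightarrow> rel (x - y) (a - b)"
    and p: "prime p" and J: "finite J"
    and "\<And>r v. r \<in> J \<Longrightarrow> v \<in> V \<Longrightarrow> rel (c r v) (b r v)"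
    and "indep_mod p V b J"
    and "\<And>v. v \<in> V \<Longrightarrow> (\<Sum>r\<in>J. \<mu> r * c r v) = 0"
  shows "\<forall>r\<in>J. \<mu> r = 0"
  using J assms(6-)
proof (induction J arbitrary: b c \<mu> rule: finite_induct)
  case empty
  thus ?case by simp
next
  case (insert r0 J)
  have pint: "prime (int p)" using p by simp
  have "\<exists>v0\<in>V. \<not> int p dvd b r0 v0"
  proof (rule ccontr)
    assume "\<not> ?thesis"
    moreover have "(\<Sum>r\<in>insert r0 J. (if r = r0 then 1 else 0) * b r v) = b r0 v" for v
    proof -
      have "(\<Sum>r\<in>J. (if r = r0 then 1 else 0) * b r v) = 0"
        using insert.hyps by (intro sum.neutral) auto
      thus ?thesis using insert.hyps by simp
    qed
    ultimately have "\<forall>v\<in>V. int p dvd (\<Sum>r\<in>insert r0 J. (if r = r0 then 1 else 0) * b r v)" by simp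
    hence "int p dvd (if r0 = r0 then 1 else 0)"
      using insert.prems(2)[unfolded indep_mod_def, rule_format, of "\<lambda>r. if r = r0 then 1 else 0" r0] by blast
    thus False using p by auto
  qed
  then obtain v0 where v0: "v0 \<in> V" "\<not> int p dvd b r0 v0" by blast
  define c' where "c' = (\<lambda>r v. c r0 v0 * c r v - c r v0 * c r0 v)"
  define b' where "b' = (\<lambda>r v. b r0 v0 * b r v - b r v0 * b r0 v)"
  have c0: "c r0 v0 \<noteq> 0" using insert.prems(1)[of r0 v0] v0 rel_0 by auto
  have sum0: "\<mu> r0 * c r0 v + (\<Sum>r\<in>J. \<mu> r * c r v) = 0" if "v \<in> V" for v
    using insert.prems(3)[OF that] insert.hyps by simp
  have "\<forall>r\<in>J. \<mu> r = 0"
  proof (rule insert.IH)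
    show "rel (c' r v) (b' r v)" if "r \<in> J" "v \<in> V" for r v
      using that v0 insert.prems(1) unfolding c'_def b'_def by (intro rel_diff rel_mult) auto
    show "indep_mod p V b' J" unfolding indep_mod_def
    proof (intro allI impI)
      fix l assume l: "\<forall>v\<in>V. int p dvd (\<Sum>r\<in>J. l r * b' r v)"
      define l' where "l' = (\<lambda>r. if r = r0 then - (\<Sum>r\<in>J. l r * b r v0) else b r0 v0 * l r)"
      have "(\<Sum>r\<in>insert r0 J. l' r * b r v) = (\<Sum>r\<in>J. l r * b' r v)" for v
      proof -
        have "(\<Sum>r\<in>J. l' r * b r v) = (\<Sum>r\<in>J. b r0 v0 * l r * b r v)"
          using insert.hyps by (intro sum.cong) (auto simp: l'_def)
        thus ?thesis using insert.hyps
          by (simp add: l'_def b'_def algebra_simps sum_subtractf sum_distrib_left)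
      qed
      hence "\<forall>r\<in>insert r0 J. int p dvd l' r"
        using l insert.prems(2) unfolding indep_mod_def by simp
      hence dvd: "int p dvd l' r" if "r \<in> J" for r using that by blast
      show "\<forall>r\<in>J. int p dvd l r"
      proof
        fix r assume "r \<in> J"
        moreover from this have "r \<noteq> r0" using insert.hyps by blast
        ultimately have "int p dvd b r0 v0 * l r" using dvd[of r] by (simp add: l'_def)
        thus "int p dvd l r" using v0 pint by (simp add: prime_dvd_mult_iff)
      qed
    qed
    show "(\<Sum>r\<in>J. \<mu> r * c' r v) = 0" if "v \<in> V" for v
    proof -
      have "(\<Sum>r\<in>J. \<mu> r * c' r v) = c r0 v0 * (\<Sum>r\<in>J. \<mu> r * c r v) - c r0 v * (\<Sum>r\<in>J. \<mu> r * c r v0)"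
        by (simp add: c'_def algebra_simps sum_subtractf sum_distrib_left)
      also have "\<dots> = c r0 v0 * (- (\<mu> r0 * c r0 v)) - c r0 v * (- (\<mu> r0 * c r0 v0))"
        using sum0[OF that] sum0[OF v0(1)] by (simp add: add_eq_0_iff)
      finally show ?thesis by (simp add: algebra_simps)
    qed
  qed
  moreover from this have "\<mu> r0 = 0" using sum0[OF v0(1)] c0 by simp
  ultimately show ?case by simp
qed

section \<open>Truncated polynomials modulo a prime\<close>

definition one_plus_w :: "'a :: comm_ring_1 poly" where "one_plus_w = [:1, 1:]"

lemma coeff_one_plus_w_power: "coeff ((one_plus_w :: 'a :: comm_ring_1 poly) ^ e) j = of_nat (e choose j)"
proof (cases "j \<le> e")
  case True
  thus ?thesis by (simp add: one_plus_w_def coeff_linear_poly_power)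
next
  case False
  have "degree ((one_plus_w :: 'a poly) ^ e) \<le> degree (one_plus_w :: 'a poly) * e" by (rule degree_power_le)
  also have "\<dots> \<le> e" by (simp add: one_plus_w_def)
  finally have "coeff ((one_plus_w :: 'a poly) ^ e) j = 0" using False by (intro coeff_eq_0) simp
  thus ?thesis using False by (simp add: binomial_eq_0)
qed

text \<open>Membership in the ideal generated by \<^term>\<open>p\<close> and the \<^term>\<open>M\<close>-th power of the variable.\<close>

definition vanish_mod :: "nat \<Rightarrow> nat \<Rightarrow> int poly \<Rightarrow> bool" where
  "vanish_mod p M Q \<longleftrightarrow> (\<forall>j<M. int p dvd coeff Q j)"

lemma vanish_mod_0 [simp]: "vanish_mod p M 0"
  by (simp add: vanish_mod_def)

lemma vanish_mod_add: "vanish_mod p M P \<Longrightarrow> vanish_mod p M Q \<Longrightarrow> vanish_mod p M (P + Q)"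
  by (simp add: vanish_mod_def)

lemma vanish_mod_diff: "vanish_mod p M P \<Longrightarrow> vanish_mod p M Q \<Longrightarrow> vanish_mod p M (P - Q)"
  by (simp add: vanish_mod_def)

lemma vanish_mod_sum: "(\<And>i. i \<in> A \<Longrightarrow> vanish_mod p M (f i)) \<Longrightarrow> vanish_mod p M (\<Sum>i\<in>A. f i)"
  by (induction A rule: infinite_finite_induct) (auto intro: vanish_mod_add)

lemma vanish_mod_mult: "vanish_mod p M Q \<Longrightarrow> vanish_mod p M (P * Q)"
  unfolding vanish_mod_def coeff_mult by (auto intro!: dvd_sum dvd_mult)

lemma vanish_mod_pcompose:
  assumes "coeff H 0 = 0" "vanish_mod p M Q"
  shows "vanish_mod p M (pcompose Q H)"
  using assms(2)
proof (induction Q arbitrary: M)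
  case (pCons a Q)
  obtain H' where H: "H = pCons 0 H'" using assms(1) by (cases H) auto
  show ?case
  proof (cases M)
    case (Suc M')
    have a: "int p dvd a" using pCons.prems Suc by (force simp: vanish_mod_def)
    have "vanish_mod p M' Q"
      using pCons.prems Suc unfolding vanish_mod_def by (metis Suc_less_eq coeff_pCons_Suc)
    hence "vanish_mod p M' (H' * pcompose Q H)" by (intro vanish_mod_mult pCons.IH)
    hence "vanish_mod p M (pCons a (H' * pcompose Q H))"
      using a Suc by (auto simp: vanish_mod_def coeff_pCons split: nat.split)
    also have "pCons a (H' * pcompose Q H) = pcompose (pCons a Q) H"
      by (simp add: pcompose_pCons H)
    finally show ?thesis .
  qed (simp add: vanish_mod_def)
qed simp

lemma pcompose_one_plus_w_power:
  "pcompose (one_plus_w ^ e) (one_plus_w ^ c - 1) = (one_plus_w :: int poly) ^ (c * e)"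
proof -
  have "pcompose (one_plus_w ^ e) (one_plus_w ^ c - 1) = (pcompose one_plus_w (one_plus_w ^ c - 1)) ^ e"
    by (induction e) (simp_all add: pcompose_1 pcompose_mult)
  also have "pcompose (one_plus_w :: int poly) (one_plus_w ^ c - 1) = one_plus_w ^ c"
    by (simp add: one_plus_w_def pcompose_pCons pcompose_1 flip: one_pCons)
  finally show ?thesis by (simp add: power_mult)
qed

lemma prime_dvd_prime_power_choose:
  assumes "prime p" "0 < j" "j < p ^ L"
  shows "p dvd (p ^ L choose j)"
proof (rule ccontr)
  assume "\<not> p dvd (p ^ L choose j)"
  hence "coprime (p ^ L) (p ^ L choose j)" using assms(1) by (simp add: prime_imp_coprime)
  moreover have "p ^ L dvd j * (p ^ L choose j)"
    using assms(2) by (simp add: times_binomial_minus1_eq)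
  ultimately have "p ^ L dvd j" by (simp add: coprime_dvd_mult_left_iff)
  thus False using assms by (auto dest: dvd_imp_le)
qed

lemma vanish_mod_one_plus_w_power_diff:
  assumes p: "prime p" and ab: "[a = b] (mod p ^ L)"
  shows "vanish_mod p (p ^ L) (one_plus_w ^ a - one_plus_w ^ b)"
proof -
  let ?z = "one_plus_w :: int poly"
  have step: "vanish_mod p (p ^ L) (?z ^ (p ^ L) - 1)"
    unfolding vanish_mod_def
  proof (intro allI impI)
    fix j assume j: "j < p ^ L"
    show "int p dvd coeff (?z ^ (p ^ L) - 1) j"
    proof (cases "j = 0")
      case False
      hence "coeff (?z ^ (p ^ L) - 1) j = int (p ^ L choose j)"
        by (simp add: coeff_one_plus_w_power)
      thus ?thesis using prime_dvd_prime_power_choose[OF p, of j L] False j by simp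
    qed (simp add: coeff_one_plus_w_power)
  qed
  have multi: "vanish_mod p (p ^ L) (?z ^ (c + t * p ^ L) - ?z ^ c)" for c t
  proof (induction t)
    case (Suc t)
    have "?z ^ (c + Suc t * p ^ L) - ?z ^ c =
      ?z ^ (c + t * p ^ L) * (?z ^ (p ^ L) - 1) + (?z ^ (c + t * p ^ L) - ?z ^ c)"
      by (simp add: algebra_simps power_add)
    thus ?case by (simp only:) (intro vanish_mod_add vanish_mod_mult step Suc)
  qed simp
  have "vanish_mod p (p ^ L) (?z ^ a - ?z ^ (a mod p ^ L))" for a
    using multi[of "a mod p ^ L" "a div p ^ L"] by (simp only: mod_div_mult_eq)
  from vanish_mod_diff[OF this[of a] this[of b]] show ?thesis using ab by (simp add: cong_def)
qed

lemma choose_cong_prime_power: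
  assumes "prime p" "[a = b] (mod p ^ L)" "j < p ^ L"
  shows "[int (a choose j) = int (b choose j)] (mod int p)"
  using vanish_mod_one_plus_w_power_diff[OF assms(1,2)] assms(3)
  by (auto simp: vanish_mod_def coeff_one_plus_w_power cong_iff_dvd_diff)

definition order_le :: "nat \<Rightarrow> int poly \<Rightarrow> nat \<Rightarrow> bool" where
  "order_le p Q e \<longleftrightarrow> (\<exists>j\<le>e. \<not> int p dvd coeff Q j)"

lemma order_le_mult:
  assumes p: "prime p" and "order_le p P a" "order_le p Q b"
  shows "order_le p (P * Q) (a + b)"
proof -
  define i where "i = (LEAST i. \<not> int p dvd coeff P i)"
  define j where "j = (LEAST j. \<not> int p dvd coeff Q j)"
  from assms obtain i' j' where i': "i' \<le> a" "\<not> int p dvd coeff P i'"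
    and j': "j' \<le> b" "\<not> int p dvd coeff Q j'" by (auto simp: order_le_def)
  have i: "\<not> int p dvd coeff P i" "i \<le> a" "\<And>l. l < i \<Longrightarrow> int p dvd coeff P l"
    unfolding i_def using LeastI[of "\<lambda>i. \<not> int p dvd coeff P i", OF i'(2)]
      Least_le[of "\<lambda>i. \<not> int p dvd coeff P i", OF i'(2)] i'(1) not_less_Least by auto
  have j: "\<not> int p dvd coeff Q j" "j \<le> b" "\<And>l. l < j \<Longrightarrow> int p dvd coeff Q l"
    unfolding j_def using LeastI[of "\<lambda>j. \<not> int p dvd coeff Q j", OF j'(2)]
      Least_le[of "\<lambda>j. \<not> int p dvd coeff Q j", OF j'(2)] j'(1) not_less_Least by auto
  have "coeff (P * Q) (i + j) = (\<Sum>l\<in>insert i ({..i + j} - {i}). coeff P l * coeff Q (i + j - l))"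
    unfolding coeff_mult by (intro sum.cong) auto
  also have "\<dots> = coeff P i * coeff Q j + (\<Sum>l\<in>{..i + j} - {i}. coeff P l * coeff Q (i + j - l))"
    by (subst sum.insert) auto
  finally have eq: "coeff (P * Q) (i + j) = \<dots>" .
  have "int p dvd (\<Sum>l\<in>{..i + j} - {i}. coeff P l * coeff Q (i + j - l))"
  proof (rule dvd_sum)
    fix l assume l: "l \<in> {..i + j} - {i}"
    show "int p dvd coeff P l * coeff Q (i + j - l)"
    proof (cases "l < i")
      case True
      thus ?thesis using i by simp
    next
      case False
      hence "i + j - l < j" using l by auto
      thus ?thesis using j by simp
    qed
  qed
  moreover have "\<not> int p dvd coeff P i * coeff Q j"
    using i j p by (simp add: prime_dvd_mult_iff)
  ultimately have "\<not> int p dvd coeff (P * Q) (i + j)" unfolding eq by (simp add: dvd_add_left_iff)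
  thus ?thesis unfolding order_le_def using i j by (auto intro!: exI[of _ "i + j"])
qed

lemma order_le_1: "prime p \<Longrightarrow> order_le p 1 0"
  by (auto simp: order_le_def)

lemma order_le_prod:
  assumes "prime p" "\<And>i. i \<in> A \<Longrightarrow> order_le p (f i) (e i)"
  shows "order_le p (\<Prod>i\<in>A. f i) (\<Sum>i\<in>A. e i)"
  using assms(2)
  by (induction A rule: infinite_finite_induct)
    (auto intro!: order_le_mult order_le_1 simp: assms(1))

lemma order_le_one_plus_w_power_diff:
  assumes p: "prime p" and jt: "j < t"
  shows "order_le p (one_plus_w ^ t - one_plus_w ^ j) (p ^ multiplicity p (t - j))"
proof -
  let ?z = "one_plus_w :: int poly"
  define d where "d = t - j"
  define s where "s = multiplicity p d"
  have d: "d > 0" using jt by (simp add: d_def)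
  have p1: "p > 1" using p prime_gt_1_nat by blast
  obtain m where m: "d = p ^ s * m" using multiplicity_dvd[of p d] unfolding s_def by (elim dvdE)
  have m0: "m > 0" using d m by auto
  have "\<not> p dvd m"
  proof
    assume "p dvd m"
    hence "p ^ Suc s dvd d" using m by (auto simp: mult.commute)
    hence "Suc s \<le> multiplicity p d" using d p1 by (intro multiplicity_geI) auto
    thus False by (simp add: s_def)
  qed
  hence "multiplicity p m = 0" by (simp add: not_dvd_imp_multiplicity_0)
  hence "multiplicity p (p ^ s * m choose p ^ s) = 0" using const_p_fac[OF m0 p, of s] by simp
  moreover have "p ^ s * m choose p ^ s \<noteq> 0" using m0 by simp
  ultimately have "\<not> p dvd (d choose p ^ s)"
    unfolding m using p1 multiplicity_eq_zero_iff[of "p ^ s * m choose p ^ s" p] by auto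
  moreover have "p ^ s > 0" using p1 by simp
  ultimately have "order_le p (?z ^ d - 1) (p ^ s)"
    unfolding order_le_def by (intro exI[of _ "p ^ s"]) (auto simp: coeff_one_plus_w_power)
  moreover have "order_le p (?z ^ j) 0"
    using p by (auto simp: order_le_def coeff_one_plus_w_power)
  ultimately have "order_le p (?z ^ j * (?z ^ d - 1)) (0 + p ^ s)" by (intro order_le_mult p)
  also have "?z ^ j * (?z ^ d - 1) = ?z ^ t - ?z ^ j"
    using jt by (simp add: d_def algebra_simps flip: power_add)
  finally show ?thesis by (simp add: s_def d_def)
qed

lemma sum_prime_power_multiplicity_le:
  assumes p: "prime p" and t: "t < p ^ L"
  shows "(\<Sum>d=1..t. p ^ multiplicity p d) \<le> L * t"
proof -
  have p1: "p > 1" using p prime_gt_1_nat by blast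
  have "(\<Sum>d=1..t. p ^ multiplicity p d) \<le> (\<Sum>d=1..t. \<Sum>s<L. if p ^ s dvd d then p ^ s else 0)"
  proof (rule sum_mono)
    fix d assume d: "d \<in> {1..t}"
    have dvd: "p ^ multiplicity p d dvd d" by (rule multiplicity_dvd)
    have "p ^ multiplicity p d < p ^ L" using dvd_imp_le[OF dvd] d t by simp
    hence "multiplicity p d < L" using p1 by simp
    hence "(\<Sum>s\<in>{multiplicity p d}. if p ^ s dvd d then p ^ s else 0) \<le> (\<Sum>s<L. if p ^ s dvd d then p ^ s else 0)"
      by (intro sum_mono2) auto
    thus "p ^ multiplicity p d \<le> (\<Sum>s<L. if p ^ s dvd d then p ^ s else 0)" using dvd by simp
  qed
  also have "\<dots> = (\<Sum>s<L. \<Sum>d=1..t. if p ^ s dvd d then p ^ s else 0)" by (rule sum.swap)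
  also have "\<dots> \<le> (\<Sum>s<L. t)"
  proof (rule sum_mono)
    fix s assume "s \<in> {..<L}"
    have ps: "p ^ s > 0" using p1 by simp
    have "{d\<in>{1..t}. p ^ s dvd d} \<subseteq> (\<lambda>i. p ^ s * i) ` {1..t div p ^ s}"
    proof
      fix d assume d: "d \<in> {d\<in>{1..t}. p ^ s dvd d}"
      then obtain i where i: "d = p ^ s * i" by auto
      have "i \<le> t div p ^ s" using d i ps by (simp add: less_eq_div_iff_mult_less_eq mult.commute)
      moreover have "i \<ge> 1" using d i by (cases i) auto
      ultimately show "d \<in> (\<lambda>i. p ^ s * i) ` {1..t div p ^ s}" using i by auto
    qed
    hence "card {d\<in>{1..t}. p ^ s dvd d} \<le> card {1..t div p ^ s}"
      by (rule surj_card_le[rotated]) simp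
    hence "card {d\<in>{1..t}. p ^ s dvd d} * p ^ s \<le> t div p ^ s * p ^ s" by (intro mult_right_mono) auto
    also have "\<dots> \<le> t" by (rule div_times_less_eq_dividend)
    finally have "card {d\<in>{1..t}. p ^ s dvd d} * p ^ s \<le> t" .
    moreover have "(\<Sum>d=1..t. if p ^ s dvd d then p ^ s else 0) = (\<Sum>d\<in>{d\<in>{1..t}. p ^ s dvd d}. p ^ s)"
      by (rule sum.inter_filter[symmetric]) simp
    ultimately show "(\<Sum>d=1..t. if p ^ s dvd d then p ^ s else 0) \<le> t" by simp
  qed
  finally show ?thesis by simp
qed

text \<open>The polynomial whose roots are the first \<^term>\<open>t\<close> powers of \<open>z = 1 + w\<close>. Since the
  matrix with entries \<open>z\<close> to the power \<open>u s\<close> is symmetric in \<open>u\<close> and \<open>s\<close>, its coefficients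
  serve as the weights that triangularise that matrix.\<close>

definition newton_poly :: "nat \<Rightarrow> int poly poly" where
  "newton_poly t = (\<Prod>j<t. [:- (one_plus_w ^ j), 1:])"

lemma poly_newton_poly: "poly (newton_poly t) x = (\<Prod>j<t. x - one_plus_w ^ j)"
  by (simp add: newton_poly_def poly_prod)

lemma degree_newton_poly: "degree (newton_poly t) = t"
  unfolding newton_poly_def by (subst degree_prod_eq_sum_degree) auto

lemma sum_newton_poly: "(\<Sum>u\<le>t. coeff (newton_poly t) u * x ^ u) = (\<Prod>j<t. x - one_plus_w ^ j)"
  using poly_altdef[of "newton_poly t" x] by (simp add: degree_newton_poly poly_newton_poly)

lemma order_le_newton:
  assumes p: "prime p" and t: "t < p ^ L"
  shows "order_le p (\<Prod>j<t. one_plus_w ^ t - one_plus_w ^ j) (L * t)"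
proof -
  have "order_le p (\<Prod>j<t. one_plus_w ^ t - one_plus_w ^ j) (\<Sum>j<t. p ^ multiplicity p (t - j))"
    by (intro order_le_prod order_le_one_plus_w_power_diff p) auto
  moreover have "(\<Sum>j<t. p ^ multiplicity p (t - j)) = (\<Sum>d=1..t. p ^ multiplicity p d)"
    by (rule sum.reindex_bij_witness[of _ "\<lambda>d. t - d" "\<lambda>j. t - j"]) auto
  ultimately obtain j where "j \<le> (\<Sum>d=1..t. p ^ multiplicity p d)"
    "\<not> int p dvd coeff (\<Prod>j<t. one_plus_w ^ t - one_plus_w ^ j) j"
    unfolding order_le_def by auto
  with sum_prime_power_multiplicity_le[OF p t] show ?thesis
    unfolding order_le_def by (intro exI[of _ j]) simp
qed

definition dotp :: "nat \<Rightarrow> (nat \<Rightarrow> nat) \<Rightarrow> (nat \<Rightarrow> nat) \<Rightarrow> nat" where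
  "dotp n u v = (\<Sum>i<n. u i * v i)"

definition grid :: "nat \<Rightarrow> nat \<Rightarrow> (nat \<Rightarrow> nat) set" where
  "grid n q = {..<n} \<rightarrow>\<^sub>E {..<q}"

definition prims :: "nat \<Rightarrow> nat \<Rightarrow> nat \<Rightarrow> (nat \<Rightarrow> nat) set" where
  "prims p n q = {u \<in> grid n q. \<exists>i<n. \<not> p dvd u i}"

lemma grid_less: "u \<in> grid n q \<Longrightarrow> i < n \<Longrightarrow> u i < q"
  by (auto simp: grid_def PiE_iff)

lemma finite_grid [simp]: "finite (grid n q)"
  by (auto simp: grid_def intro!: finite_PiE)

lemma grid_eqI:
  assumes "u \<in> grid n q" "v \<in> grid n q'" "\<And>i. i < n \<Longrightarrow> u i = v i"
  shows "u = v"
proof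
  fix i
  show "u i = v i"
    using assms by (cases "i < n") (auto simp: grid_def PiE_iff extensional_def)
qed

definition specialize :: "nat \<Rightarrow> (nat \<Rightarrow> nat) set \<Rightarrow> ((nat \<Rightarrow> nat) \<Rightarrow> int) \<Rightarrow> (nat \<Rightarrow> nat) \<Rightarrow> int poly" where
  "specialize n T \<delta> u = (\<Sum>v\<in>T. smult (\<delta> v) (one_plus_w ^ dotp n u v))"

lemma specialize_vanish_imp:
  assumes p: "prime p" and T: "finite T" "T \<subseteq> grid n (p ^ L)"
    and small: "\<And>v. v \<in> T \<Longrightarrow> L * (\<Sum>i<n. v i) < M"
    and van: "\<And>u. u \<in> grid n (p ^ L) \<Longrightarrow> vanish_mod p M (specialize n T \<delta> u)"
    and v: "v \<in> T"
  shows "int p dvd \<delta> v"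
proof (rule ccontr)
  let ?z = "one_plus_w :: int poly"
  define T' where "T' = {v\<in>T. \<not> int p dvd \<delta> v}"
  assume "\<not> int p dvd \<delta> v"
  hence "finite T'" "T' \<noteq> {}" using T v by (auto simp: T'_def)
  hence "Max ((\<lambda>v. \<Sum>i<n. v i) ` T') \<in> (\<lambda>v. \<Sum>i<n. v i) ` T'" by (intro Max_in) auto
  then obtain t where t: "t \<in> T'" and "(\<Sum>i<n. t i) = Max ((\<lambda>v. \<Sum>i<n. v i) ` T')" by auto
  hence max: "(\<Sum>i<n. v i) \<le> (\<Sum>i<n. t i)" if "v \<in> T'" for v
    using that \<open>finite T'\<close> by auto
  have tT: "t \<in> T" "\<not> int p dvd \<delta> t" using t by (auto simp: T'_def)
  define B where "B = PiE {..<n} (\<lambda>i. {..t i})"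
  define K where "K = (\<lambda>u. \<Prod>i<n. coeff (newton_poly (t i)) (u i))"
  define P where "P = (\<lambda>v. \<Prod>i<n. \<Prod>j<t i. ?z ^ v i - ?z ^ j)"
  have BX: "B \<subseteq> grid n (p ^ L)"
  proof
    fix u assume u: "u \<in> B"
    have "u i < p ^ L" if "i < n" for i
    proof -
      have "u i \<le> t i" using u that by (auto simp: B_def PiE_iff)
      also have "t i < p ^ L" using T tT grid_less that by blast
      finally show ?thesis .
    qed
    thus "u \<in> grid n (p ^ L)" using u by (auto simp: B_def grid_def PiE_iff)
  qed
  have KP: "(\<Sum>u\<in>B. K u * ?z ^ dotp n u v) = P v" for v
  proof -
    have "P v = (\<Prod>i<n. \<Sum>u\<le>t i. coeff (newton_poly (t i)) u * (?z ^ v i) ^ u)"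
      by (simp add: P_def sum_newton_poly)
    also have "\<dots> = (\<Sum>u\<in>B. \<Prod>i<n. coeff (newton_poly (t i)) (u i) * (?z ^ v i) ^ u i)"
      unfolding B_def by (rule prod_sum_PiE) auto
    also have "\<dots> = (\<Sum>u\<in>B. K u * ?z ^ dotp n u v)"
      by (intro sum.cong refl)
        (simp add: K_def dotp_def prod.distrib power_sum mult.commute flip: power_mult)
    finally show ?thesis by simp
  qed
  have "vanish_mod p M (\<Sum>u\<in>B. K u * specialize n T \<delta> u)"
    using BX by (intro vanish_mod_sum vanish_mod_mult van) auto
  also have "(\<Sum>u\<in>B. K u * specialize n T \<delta> u) = (\<Sum>u\<in>B. \<Sum>v\<in>T. smult (\<delta> v) (K u * ?z ^ dotp n u v))"
    by (simp add: specialize_def sum_distrib_left)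
  also have "\<dots> = (\<Sum>v\<in>T. \<Sum>u\<in>B. smult (\<delta> v) (K u * ?z ^ dotp n u v))" by (rule sum.swap)
  also have "\<dots> = (\<Sum>v\<in>T. smult (\<delta> v) (P v))"
  proof (intro sum.cong refl)
    fix v
    have "(\<Sum>u\<in>B. smult (\<delta> v) (K u * ?z ^ dotp n u v)) = [:\<delta> v:] * (\<Sum>u\<in>B. K u * ?z ^ dotp n u v)"
      by (simp add: sum_distrib_left)
    thus "(\<Sum>u\<in>B. smult (\<delta> v) (K u * ?z ^ dotp n u v)) = smult (\<delta> v) (P v)" by (simp add: KP)
  qed
  also have "\<dots> = smult (\<delta> t) (P t) + (\<Sum>v\<in>T - {t}. smult (\<delta> v) (P v))"
    using T tT by (simp add: sum.remove)
  finally have total: "vanish_mod p M (smult (\<delta> t) (P t) + (\<Sum>v\<in>T - {t}. smult (\<delta> v) (P v)))" .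
  have rest: "vanish_mod p M (\<Sum>v\<in>T - {t}. smult (\<delta> v) (P v))"
  proof (rule vanish_mod_sum)
    fix v assume v: "v \<in> T - {t}"
    show "vanish_mod p M (smult (\<delta> v) (P v))"
    proof (cases "int p dvd \<delta> v")
      case True
      thus ?thesis by (simp add: vanish_mod_def)
    next
      case False
      have "\<exists>i<n. v i < t i"
      proof (rule ccontr)
        assume "\<not> ?thesis"
        hence neg: "t i \<le> v i" if "i < n" for i using that not_less by blast
        have "(\<Sum>i<n. v i) \<le> (\<Sum>i<n. t i)" using max v False by (simp add: T'_def)
        moreover have "(\<Sum>i<n. t i) < (\<Sum>i<n. v i)" if "\<exists>i<n. t i < v i"
          using that neg by (intro sum_strict_mono_ex1) auto
        ultimately have "\<not> (\<exists>i<n. t i < v i)" by (meson leD)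
        hence "v i = t i" if "i < n" for i using neg[OF that] that by (meson le_antisym not_less)
        hence "v = t" using T tT v by (intro grid_eqI[of v n "p ^ L" t "p ^ L"]) auto
        thus False using v by simp
      qed
      then obtain i where i: "i < n" "v i < t i" by blast
      have "(\<Prod>j<t i. ?z ^ v i - ?z ^ j) = 0" using i by (intro prod_zero) auto
      hence "P v = 0" using i unfolding P_def by (intro prod_zero) auto
      thus ?thesis by simp
    qed
  qed
  have "vanish_mod p M (smult (\<delta> t) (P t))" using vanish_mod_diff[OF total rest] by simp
  moreover have "order_le p (P t) (\<Sum>i<n. L * t i)"
    unfolding P_def using T tT grid_less by (intro order_le_prod order_le_newton p) auto
  then obtain j where "j \<le> L * (\<Sum>i<n. t i)" "\<not> int p dvd coeff (P t) j"
    by (auto simp: order_le_def sum_distrib_left)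
  ultimately show False
    using small[OF tT(1)] tT(2) p by (auto simp: vanish_mod_def prime_dvd_mult_iff)
qed

lemma specialize_scale:
  assumes "\<And>i. i < n \<Longrightarrow> u i = c * u' i" "vanish_mod p M (specialize n T \<delta> u')"
  shows "vanish_mod p M (specialize n T \<delta> u)"
proof -
  have "dotp n u v = c * dotp n u' v" for v
    using assms(1) by (simp add: dotp_def sum_distrib_left mult.assoc)
  hence "specialize n T \<delta> u = pcompose (specialize n T \<delta> u') (one_plus_w ^ c - 1)"
    by (simp add: specialize_def pcompose_sum pcompose_smult pcompose_one_plus_w_power)
  thus ?thesis using assms(2) by (simp add: vanish_mod_pcompose coeff_one_plus_w_power)
qed

text \<open>The substitution \<open>z \<mapsto> z\<^sup>c\<close> reduces arbitrary vectors to primitive ones.\<close>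

lemma specialize_vanish_if_prims:
  assumes p: "prime p" and n: "n \<ge> 1" and L: "L \<ge> 1"
    and van: "\<And>u. u \<in> prims p n (p ^ L) \<Longrightarrow> vanish_mod p M (specialize n T \<delta> u)"
    and "u \<in> grid n (p ^ L)"
  shows "vanish_mod p M (specialize n T \<delta> u)"
  using assms(5)
proof (induction "\<Sum>i<n. u i" arbitrary: u rule: less_induct)
  case less
  have p1: "p > 1" using p prime_gt_1_nat by blast
  have pL: "p ^ L > 1" using one_less_power[OF p1, of L] L by simp
  show ?case
  proof (cases "\<exists>i<n. \<not> p dvd u i")
    case True
    thus ?thesis using less.prems van by (auto simp: prims_def)
  next
    case False
    show ?thesis
    proof (cases "\<exists>i<n. u i \<noteq> 0")
      case True
      then obtain i where i: "i < n" "u i \<noteq> 0" by blast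
      define u' where "u' = (\<lambda>i\<in>{..<n}. u i div p)"
      have u': "u i = p * u' i" if "i < n" for i using that False by (simp add: u'_def)
      have "u' j \<le> u j" if "j < n" for j using that by (simp add: u'_def)
      moreover have "u' i < u i" using i p1 by (simp add: u'_def)
      ultimately have "(\<Sum>i<n. u' i) < (\<Sum>i<n. u i)"
        using i by (intro sum_strict_mono_ex1) auto
      moreover have "u' \<in> grid n (p ^ L)"
        using grid_less[OF less.prems] unfolding grid_def u'_def
        by (auto intro: le_less_trans[OF div_le_dividend])
      ultimately have "vanish_mod p M (specialize n T \<delta> u')" by (rule less.hyps)
      with u' show ?thesis by (rule specialize_scale)
    next
      case zero: False
      define e where "e = (\<lambda>i\<in>{..<n}. 1 :: nat)"
      have "e \<in> prims p n (p ^ L)"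
        using pL n p1 by (auto simp: prims_def grid_def e_def intro!: exI[of _ 0])
      hence "vanish_mod p M (specialize n T \<delta> e)" by (rule van)
      moreover have "u i = 0 * e i" if "i < n" for i using zero that by simp
      ultimately show ?thesis by (rule specialize_scale[rotated])
    qed
  qed
qed

section \<open>Symmetries and averaging\<close>

definition adjoint_mod :: "nat \<Rightarrow> nat \<Rightarrow> ((nat \<Rightarrow> nat) \<Rightarrow> nat \<Rightarrow> nat) \<Rightarrow> ((nat \<Rightarrow> nat) \<Rightarrow> nat \<Rightarrow> nat) \<Rightarrow> bool" where
  "adjoint_mod n q A B \<longleftrightarrow>
     (\<forall>u\<in>grid n q. \<forall>v\<in>grid n q. [dotp n (A u) v = dotp n u (B v)] (mod q))"

text \<open>A coordinate-free description of \<open>GL\<^sub>n\<close> over the integers modulo \<^term>\<open>q\<close>: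
  a map of a finite free module that has an adjoint is linear.\<close>

definition gl :: "nat \<Rightarrow> nat \<Rightarrow> ((nat \<Rightarrow> nat) \<Rightarrow> nat \<Rightarrow> nat) set" where
  "gl n q = {A. A permutes grid n q \<and> (\<exists>B. B permutes grid n q \<and> adjoint_mod n q A B)}"

lemma finite_gl: "finite (gl n q)"
  by (rule finite_subset[OF _ finite_permutations[OF finite_grid[of n q]]]) (auto simp: gl_def)

lemma gl_grid: "A \<in> gl n q \<Longrightarrow> u \<in> grid n q \<Longrightarrow> A u \<in> grid n q"
  by (auto simp: gl_def permutes_in_image)

lemma id_in_gl: "id \<in> gl n q"
  by (auto simp: gl_def permutes_id adjoint_mod_def intro!: exI[of _ id])

lemma gl_comp:
  assumes "A \<in> gl n q" "A' \<in> gl n q"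
  shows "A \<circ> A' \<in> gl n q"
proof -
  obtain B B' where B: "B permutes grid n q" "adjoint_mod n q A B"
    and B': "B' permutes grid n q" "adjoint_mod n q A' B'"
    using assms by (auto simp: gl_def)
  have "adjoint_mod n q (A \<circ> A') (B' \<circ> B)"
    unfolding adjoint_mod_def
  proof (intro ballI)
    fix u v assume uv: "u \<in> grid n q" "v \<in> grid n q"
    have "A' u \<in> grid n q" "B v \<in> grid n q"
      using uv assms B by (auto simp: gl_grid permutes_in_image)
    hence "[dotp n (A (A' u)) v = dotp n (A' u) (B v)] (mod q)"
      "[dotp n (A' u) (B v) = dotp n u (B' (B v))] (mod q)"
      using B(2) B'(2) uv by (auto simp: adjoint_mod_def)
    thus "[dotp n ((A \<circ> A') u) v = dotp n u ((B' \<circ> B) v)] (mod q)" by (auto intro: cong_trans)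
  qed
  moreover have "A \<circ> A' permutes grid n q" "B' \<circ> B permutes grid n q"
    using assms B B' by (auto simp: gl_def intro: permutes_compose)
  ultimately show ?thesis by (auto simp: gl_def)
qed

lemma gl_inv:
  assumes "A \<in> gl n q"
  shows "inv_into UNIV A \<in> gl n q"
proof -
  obtain B where A: "A permutes grid n q" and B: "B permutes grid n q" "adjoint_mod n q A B"
    using assms by (auto simp: gl_def)
  have "adjoint_mod n q (inv_into UNIV A) (inv_into UNIV B)"
    unfolding adjoint_mod_def
  proof (intro ballI)
    fix u v assume uv: "u \<in> grid n q" "v \<in> grid n q"
    have "inv_into UNIV A u \<in> grid n q" "inv_into UNIV B v \<in> grid n q"
      using uv permutes_inv[OF A] permutes_inv[OF B(1)] by (auto simp: permutes_in_image)
    hence "[dotp n (A (inv_into UNIV A u)) (inv_into UNIV B v) = dotp n (inv_into UNIV A u) (B (inv_into UNIV B v))] (mod q)"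
      using B(2) by (auto simp: adjoint_mod_def)
    thus "[dotp n (inv_into UNIV A u) v = dotp n u (inv_into UNIV B v)] (mod q)"
      using A B by (simp add: permutes_inverses cong_sym_eq)
  qed
  thus ?thesis using permutes_inv[OF A] permutes_inv[OF B(1)] by (auto simp: gl_def)
qed

definition unit_vec :: "nat \<Rightarrow> nat \<Rightarrow> nat \<Rightarrow> nat" where
  "unit_vec n j = (\<lambda>i\<in>{..<n}. if i = j then 1 else 0)"

lemma dotp_unit_vec: "j < n \<Longrightarrow> dotp n u (unit_vec n j) = u j"
proof -
  assume "j < n"
  have "dotp n u (unit_vec n j) = (\<Sum>i<n. if i = j then u i else 0)"
    unfolding dotp_def by (intro sum.cong) (auto simp: unit_vec_def)
  thus ?thesis using \<open>j < n\<close> by simp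
qed

lemma unit_vec_grid: "q > 1 \<Longrightarrow> unit_vec n j \<in> grid n q"
  by (auto simp: grid_def unit_vec_def)

lemma gl_cong:
  assumes A: "A \<in> gl n q" and q: "q > 1" "d dvd q"
    and u: "u \<in> grid n q" "u' \<in> grid n q"
    and uu': "\<And>i. i < n \<Longrightarrow> [u i = c * u' i] (mod d)" and i: "i < n"
  shows "[A u i = c * A u' i] (mod d)"
proof -
  obtain B where B: "B permutes grid n q" "adjoint_mod n q A B"
    using A by (auto simp: gl_def)
  let ?e = "unit_vec n i"
  have e: "?e \<in> grid n q" "B ?e \<in> grid n q"
    using unit_vec_grid[OF q(1)] B(1) by (auto simp: permutes_in_image)
  have A_eq: "[A w i = dotp n w (B ?e)] (mod d)" if "w \<in> grid n q" for w
  proof -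
    have "[dotp n (A w) ?e = dotp n w (B ?e)] (mod q)"
      using B(2) that e by (auto simp: adjoint_mod_def)
    thus ?thesis using q(2) i by (simp add: dotp_unit_vec cong_dvd_modulus_nat)
  qed
  have "[dotp n u (B ?e) = (\<Sum>l<n. (c * u' l) * B ?e l)] (mod d)"
    unfolding dotp_def using uu' by (intro cong_sum cong_mult) auto
  also have "(\<Sum>l<n. (c * u' l) * B ?e l) = c * dotp n u' (B ?e)"
    by (simp add: dotp_def sum_distrib_left mult.assoc)
  finally have "[dotp n u (B ?e) = c * dotp n u' (B ?e)] (mod d)" .
  moreover have "[c * dotp n u' (B ?e) = c * A u' i] (mod d)"
    using A_eq[OF u(2)] by (intro cong_mult) (auto simp: cong_sym_eq)
  ultimately show ?thesis using A_eq[OF u(1)] by (meson cong_trans)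
qed

lemma permutes_if_inj_on_grid:
  assumes "\<And>v. v \<in> grid n q \<Longrightarrow> A v \<in> grid n q" "inj_on A (grid n q)"
  shows "(\<lambda>v. if v \<in> grid n q then A v else v) permutes grid n q"
proof (rule bij_imp_permutes)
  have "A ` grid n q = grid n q"
    using assms by (intro card_subset_eq) (auto simp: card_image)
  hence "bij_betw A (grid n q) (grid n q)" using assms by (simp add: bij_betw_def)
  thus "bij_betw (\<lambda>v. if v \<in> grid n q then A v else v) (grid n q) (grid n q)"
    by (rule bij_betw_cong[THEN iffD1, rotated]) simp
qed simp

text \<open>The matrix that agrees with the identity except that its \<^term>\<open>j\<close>-th column is \<^term>\<open>u\<close>.\<close>

lemma gl_unit_vec_to:
  assumes u: "u \<in> grid n q" and j: "j < n" and cop: "coprime (u j) q" and q: "q > 1"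
  obtains A where "A \<in> gl n q" "A (unit_vec n j) = u"
proof -
  define A where "A = (\<lambda>v :: nat \<Rightarrow> nat. \<lambda>i\<in>{..<n}. (if i = j then v j * u j else v i + v j * u i) mod q)"
  define B where "B = (\<lambda>v :: nat \<Rightarrow> nat. \<lambda>i\<in>{..<n}. if i = j then dotp n u v mod q else v i)"
  have A_grid: "A v \<in> grid n q" for v using q by (auto simp: A_def grid_def)
  have B_grid: "B v \<in> grid n q" if "v \<in> grid n q" for v
    using q grid_less[OF that] by (auto simp: B_def grid_def)
  have cancel: "x = y" if "[x * u j = y * u j] (mod q)" "x < q" "y < q" for x y
    using that cop cong_mult_rcancel_nat[of "u j" q x y] cong_less_modulus_unique_nat[of x y q] by blast
  have inj_A: "inj_on A (grid n q)"
  proof (rule inj_onI)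
    fix v w assume v: "v \<in> grid n q" and w: "w \<in> grid n q" and eq: "A v = A w"
    have "v j * u j mod q = w j * u j mod q" using fun_cong[OF eq, of j] j by (simp add: A_def)
    hence vj: "v j = w j" using cancel[of "v j" "w j"] grid_less[OF v j] grid_less[OF w j] by (simp add: cong_def)
    show "v = w"
    proof (rule grid_eqI[OF v w])
      fix i assume i: "i < n"
      show "v i = w i"
      proof (cases "i = j")
        case False
        hence "[v i + v j * u i = w i + v j * u i] (mod q)"
          using fun_cong[OF eq, of i] i vj by (simp add: A_def cong_def)
        hence "[v i = w i] (mod q)" by (simp add: cong_add_rcancel_nat)
        thus ?thesis using grid_less[OF v i] grid_less[OF w i] by (rule cong_less_modulus_unique_nat)
      qed (simp add: vj)
    qed
  qed
  have split: "dotp n x y = x j * y j + (\<Sum>i\<in>{..<n} - {j}. x i * y i)" for x y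
    unfolding dotp_def using j by (simp add: sum.remove)
  have inj_B: "inj_on B (grid n q)"
  proof (rule inj_onI)
    fix v w assume v: "v \<in> grid n q" and w: "w \<in> grid n q" and eq: "B v = B w"
    have ne: "v i = w i" if "i < n" "i \<noteq> j" for i
      using fun_cong[OF eq, of i] that by (simp add: B_def)
    have "[dotp n u v = dotp n u w] (mod q)"
      using fun_cong[OF eq, of j] j by (simp add: B_def cong_def)
    moreover have "(\<Sum>i\<in>{..<n} - {j}. u i * v i) = (\<Sum>i\<in>{..<n} - {j}. u i * w i)"
      using ne by (intro sum.cong) auto
    ultimately have "[v j * u j = w j * u j] (mod q)"
      by (simp add: split cong_add_rcancel_nat mult.commute)
    hence "v j = w j" using cancel[of "v j" "w j"] grid_less[OF v j] grid_less[OF w j] by simp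
    with ne show "v = w" by (intro grid_eqI[OF v w]) (case_tac "i = j", auto)
  qed
  define A' where "A' = (\<lambda>v. if v \<in> grid n q then A v else v)"
  define B' where "B' = (\<lambda>v. if v \<in> grid n q then B v else v)"
  have "adjoint_mod n q A' B'"
    unfolding adjoint_mod_def
  proof (intro ballI)
    fix v w assume v: "v \<in> grid n q" and w: "w \<in> grid n q"
    have "[dotp n (A v) w = v j * u j * w j + (\<Sum>i\<in>{..<n} - {j}. (v i + v j * u i) * w i)] (mod q)"
      unfolding split[of "A v"] using j
      by (intro cong_add cong_sum cong_mult) (auto simp: A_def cong_def)
    also have "v j * u j * w j + (\<Sum>i\<in>{..<n} - {j}. (v i + v j * u i) * w i)
      = v j * dotp n u w + (\<Sum>i\<in>{..<n} - {j}. v i * w i)"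
      by (simp add: split[of u] algebra_simps sum.distrib sum_distrib_left)
    also have "[\<dots> = dotp n v (B w)] (mod q)"
      unfolding split[of v "B w"] using j
      by (intro cong_add cong_sum cong_mult) (auto simp: B_def cong_def)
    finally show "[dotp n (A' v) w = dotp n v (B' w)] (mod q)" using v w by (simp add: A'_def B'_def)
  qed
  moreover have "A' permutes grid n q" "B' permutes grid n q"
    unfolding A'_def B'_def using A_grid B_grid inj_A inj_B by (intro permutes_if_inj_on_grid; simp)+
  ultimately have "A' \<in> gl n q" by (auto simp: gl_def)
  moreover have "A' (unit_vec n j) = u"
  proof -
    have "A (unit_vec n j) = u"
    proof (rule grid_eqI[OF A_grid u])
      fix i assume "i < n"
      thus "A (unit_vec n j) i = u i" using grid_less[OF u, of i] j by (auto simp: A_def unit_vec_def)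
    qed
    thus ?thesis using unit_vec_grid[OF q] by (simp add: A'_def)
  qed
  ultimately show thesis by (rule that)
qed

lemma gl_transitive_prims:
  assumes p: "prime p" and L: "L \<ge> 1"
    and u: "u \<in> prims p n (p ^ L)" and v: "v \<in> prims p n (p ^ L)"
  obtains A where "A \<in> gl n (p ^ L)" "A u = v"
proof -
  let ?q = "p ^ L"
  have q: "?q > 1" using one_less_power[of p L] prime_gt_1_nat[OF p] L by simp
  have to: "\<exists>A\<in>gl n ?q. \<exists>j<n. A (unit_vec n j) = x" if x: "x \<in> prims p n ?q" for x
  proof -
    obtain j where j: "j < n" "\<not> p dvd x j" "x \<in> grid n ?q" using x by (auto simp: prims_def)
    have "coprime p (x j)" using p j by (simp add: prime_imp_coprime)
    hence "coprime (x j) ?q" by (simp add: coprime_commute)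
    from gl_unit_vec_to[OF j(3,1) this q] obtain A where "A \<in> gl n ?q" "A (unit_vec n j) = x" by blast
    thus ?thesis using j by blast
  qed
  obtain A i where A: "A \<in> gl n ?q" "i < n" "A (unit_vec n i) = u" using to[OF u] by blast
  obtain A' j where A': "A' \<in> gl n ?q" "j < n" "A' (unit_vec n j) = v" using to[OF v] by blast
  define w where "w = (\<lambda>l\<in>{..<n}. if l = i \<or> l = j then 1 else 0 :: nat)"
  have w: "w \<in> grid n ?q" "w i = 1" "w j = 1" using q A A' prime_gt_0_nat[OF p] by (auto simp: w_def grid_def)
  obtain C where C: "C \<in> gl n ?q" "C (unit_vec n i) = w"
    using gl_unit_vec_to[OF w(1) A(2) _ q] w by auto
  obtain C' where C': "C' \<in> gl n ?q" "C' (unit_vec n j) = w"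
    using gl_unit_vec_to[OF w(1) A'(2) _ q] w by auto
  have inv: "inv_into UNIV D (D x) = x" if "D \<in> gl n ?q" for D x
    using that permutes_inverses(2)[of D "grid n ?q" x] by (simp add: gl_def)
  have "A' \<circ> (inv_into UNIV C' \<circ> (C \<circ> inv_into UNIV A)) \<in> gl n ?q"
    using A C A' C' by (intro gl_comp gl_inv)
  moreover have "(A' \<circ> (inv_into UNIV C' \<circ> (C \<circ> inv_into UNIV A))) u = v"
  proof -
    have "inv_into UNIV A u = unit_vec n i" using inv[OF A(1), of "unit_vec n i"] unfolding A(3) .
    moreover have "inv_into UNIV C' w = unit_vec n j" using inv[OF C'(1), of "unit_vec n j"] unfolding C'(2) .
    ultimately show ?thesis unfolding o_apply by (simp only: C(2) A'(3))
  qed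
  ultimately show thesis by (rule that)
qed

lemma gl_prims:
  assumes p: "prime p" and L: "L \<ge> 1" and A: "A \<in> gl n (p ^ L)" and u: "u \<in> prims p n (p ^ L)"
  shows "A u \<in> prims p n (p ^ L)"
proof -
  let ?q = "p ^ L"
  have q: "?q > 1" using one_less_power[of p L] prime_gt_1_nat[OF p] L by simp
  have dvd: "p dvd ?q" using L by (simp add: dvd_power)
  have ug: "u \<in> grid n ?q" using u by (simp add: prims_def)
  have "\<exists>i<n. \<not> p dvd A u i"
  proof (rule ccontr)
    assume neg: "\<not> ?thesis"
    have "[inv_into UNIV A (A u) i = 0 * inv_into UNIV A (A u) i] (mod p)" if "i < n" for i
    proof (rule gl_cong[OF gl_inv[OF A] q dvd gl_grid[OF A ug] gl_grid[OF A ug] _ that])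
      fix i assume "i < n"
      thus "[A u i = 0 * A u i] (mod p)" using neg by (simp add: cong_0_iff)
    qed
    moreover have "inv_into UNIV A (A u) = u"
      using A permutes_inverses(2)[of A "grid n ?q" u] by (auto simp: gl_def)
    ultimately show False using u by (auto simp: prims_def cong_0_iff)
  qed
  thus ?thesis using gl_grid[OF A ug] by (simp add: prims_def)
qed

lemma orbit_count:
  assumes G: "finite G" and comp: "\<And>g h. g \<in> G \<Longrightarrow> h \<in> G \<Longrightarrow> g \<circ> h \<in> G"
    and inj: "\<And>g. g \<in> G \<Longrightarrow> inj g"
    and trans: "\<And>x y. x \<in> P \<Longrightarrow> y \<in> P \<Longrightarrow> \<exists>g\<in>G. g x = y"
    and stable: "\<And>g x. g \<in> G \<Longrightarrow> x \<in> P \<Longrightarrow> g x \<in> P"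
    and P: "finite P" and x: "x \<in> P" and Y: "Y \<subseteq> P"
  shows "card {g\<in>G. g x \<in> Y} * card P = card G * card Y"
proof -
  define N where "N = (\<lambda>y. card {g\<in>G. g x = y})"
  have le: "N y \<le> N z" if y: "y \<in> P" and z: "z \<in> P" for y z
  proof -
    obtain h where h: "h \<in> G" "h y = z" using trans[OF y z] by blast
    have "inj_on (\<lambda>g. h \<circ> g) {g\<in>G. g x = y}"
      using inj[OF h(1)] by (auto simp: inj_on_def fun_eq_iff)
    moreover have "(\<lambda>g. h \<circ> g) ` {g\<in>G. g x = y} \<subseteq> {g\<in>G. g x = z}" using h comp by auto
    ultimately show ?thesis unfolding N_def using G by (intro card_inj_on_le) auto
  qed
  have const: "N y = N x" if "y \<in> P" for y using le[OF that x] le[OF x that] by simp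
  have count: "card {g\<in>G. g x \<in> Z} = N x * card Z" if "Z \<subseteq> P" for Z
  proof -
    have fZ: "finite Z" using that P finite_subset by blast
    have "{g\<in>G. g x \<in> Z} = (\<Union>z\<in>Z. {g\<in>G. g x = z})" by auto
    also have "card \<dots> = (\<Sum>z\<in>Z. N z)"
      unfolding N_def using G fZ by (intro card_UN_disjoint) auto
    also have "\<dots> = (\<Sum>z\<in>Z. N x)" using that const by (intro sum.cong) auto
    finally show ?thesis by simp
  qed
  have "{g\<in>G. g x \<in> P} = G" using stable x by auto
  hence "card G = N x * card P" using count[of P] by simp
  thus ?thesis using count[OF Y] by (simp add: algebra_simps)
qed

lemma orbit_average:
  assumes G: "finite G" "G \<noteq> {}" and comp: "\<And>g h. g \<in> G \<Longrightarrow> h \<in> G \<Longrightarrow> g \<circ> h \<in> G"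
    and inj: "\<And>g. g \<in> G \<Longrightarrow> inj g"
    and trans: "\<And>x y. x \<in> P \<Longrightarrow> y \<in> P \<Longrightarrow> \<exists>g\<in>G. g x = y"
    and stable: "\<And>g x. g \<in> G \<Longrightarrow> x \<in> P \<Longrightarrow> g x \<in> P"
    and P: "finite P" and Y: "Y \<subseteq> P" and J: "finite J" "\<And>r. r \<in> J \<Longrightarrow> f r \<in> P"
  obtains g where "g \<in> G" "card J * card Y \<le> card {r\<in>J. g (f r) \<in> Y} * card P"
proof -
  have "\<exists>g\<in>G. card J * card Y \<le> card {r\<in>J. g (f r) \<in> Y} * card P"
  proof (rule ccontr)
    assume neg: "\<not> ?thesis"
    have "(\<Sum>g\<in>G. card {r\<in>J. g (f r) \<in> Y} * card P) < (\<Sum>g\<in>G. card J * card Y)"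
      using neg G by (intro sum_strict_mono) auto
    also have "\<dots> = card J * (card G * card Y)" by simp
    also have "\<dots> = (\<Sum>r\<in>J. card {g\<in>G. g (f r) \<in> Y} * card P)"
    proof -
      have "card {g\<in>G. g (f r) \<in> Y} * card P = card G * card Y" if "r \<in> J" for r
        using G(1) comp inj trans stable P J(2)[OF that] Y by (rule orbit_count)
      thus ?thesis by simp
    qed
    also have "\<dots> = (\<Sum>r\<in>J. card {g\<in>G. g (f r) \<in> Y}) * card P" by (simp add: sum_distrib_right)
    also have "(\<Sum>r\<in>J. card {g\<in>G. g (f r) \<in> Y}) = (\<Sum>r\<in>J. \<Sum>g\<in>G. if g (f r) \<in> Y then 1 else 0)"
      using G by (intro sum.cong refl) (simp add: sum.If_cases Int_def)
    also have "\<dots> = (\<Sum>g\<in>G. \<Sum>r\<in>J. if g (f r) \<in> Y then 1 else 0)" by (rule sum.swap)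
    also have "\<dots> = (\<Sum>g\<in>G. card {r\<in>J. g (f r) \<in> Y})"
      using J by (intro sum.cong refl) (simp add: sum.If_cases Int_def)
    also have "\<dots> * card P = (\<Sum>g\<in>G. card {r\<in>J. g (f r) \<in> Y} * card P)"
      by (simp add: sum_distrib_right)
    finally show False by simp
  qed
  thus thesis using that by blast
qed

section \<open>Rows of rich lines\<close>

text \<open>Reduction \<open>\<zeta> \<mapsto> 1\<close> modulo the prime above \<^term>\<open>p\<close>, as a relation because its
  well-definedness is the divisibility statement \<open>prime_dvd_poly_1_if_ieval_root_unity_0\<close>.\<close>

definition reduces :: "nat \<Rightarrow> complex \<Rightarrow> complex \<Rightarrow> int \<Rightarrow> bool" where
  "reduces p z x c \<longleftrightarrow> (\<exists>Q. ieval z Q = x \<and> [poly Q 1 = c] (mod int p))"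

lemma reduces_0_imp_dvd:
  assumes "prime p" "k \<ge> 1" "reduces p (root_unity (p ^ k)) 0 c"
  shows "int p dvd c"
proof -
  obtain Q where Q: "ieval (root_unity (p ^ k)) Q = 0" "[poly Q 1 = c] (mod int p)"
    using assms(3) by (auto simp: reduces_def)
  have "int p dvd poly Q 1" using assms(1,2) Q(1) by (rule prime_dvd_poly_1_if_ieval_root_unity_0)
  thus ?thesis using Q(2) by (simp add: cong_dvd_iff)
qed

lemma reduces_mult: "reduces p z x a \<Longrightarrow> reduces p z y b \<Longrightarrow> reduces p z (x * y) (a * b)"
  unfolding reduces_def by (metis cong_mult ieval_mult poly_mult)

lemma reduces_add: "reduces p z x a \<Longrightarrow> reduces p z y b \<Longrightarrow> reduces p z (x + y) (a + b)"
  unfolding reduces_def by (metis cong_add ieval_add poly_add)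

lemma reduces_diff:
  assumes "reduces p z x a" "reduces p z y b"
  shows "reduces p z (x - y) (a - b)"
proof -
  obtain P Q where "ieval z P = x" "[poly P 1 = a] (mod int p)"
    "ieval z Q = y" "[poly Q 1 = b] (mod int p)"
    using assms by (auto simp: reduces_def)
  hence "ieval z (P + - Q) = x - y \<and> [poly (P + - Q) 1 = a - b] (mod int p)"
    by (simp add: cong_diff del: add_uminus_conv_diff)  (simp add: cong_diff)
  thus ?thesis unfolding reduces_def by blast
qed

lemma reduces_of_int: "reduces p z (of_int c) c"
  unfolding reduces_def by (intro exI[of _ "[:c:]"]) simp

lemma reduces_0: "reduces p z 0 0"
  using reduces_of_int[of p z 0] by simp

lemma reduces_1: "reduces p z 1 1"
  using reduces_of_int[of p z 1] by simp

lemma reduces_power_root: "reduces p z (z ^ e) 1"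
  unfolding reduces_def by (intro exI[of _ "monom 1 e"]) (simp add: poly_monom)

lemma reduces_sum: "(\<And>i. i \<in> A \<Longrightarrow> reduces p z (f i) (g i)) \<Longrightarrow> reduces p z (\<Sum>i\<in>A. f i) (\<Sum>i\<in>A. g i)"
  by (induction A rule: infinite_finite_induct) (auto intro: reduces_0 reduces_add)

definition reduces_poly :: "nat \<Rightarrow> complex \<Rightarrow> complex poly \<Rightarrow> int poly \<Rightarrow> bool" where
  "reduces_poly p z A B \<longleftrightarrow> (\<forall>j. reduces p z (coeff A j) (coeff B j))"

lemma reduces_poly_mult:
  "reduces_poly p z A B \<Longrightarrow> reduces_poly p z A' B' \<Longrightarrow> reduces_poly p z (A * A') (B * B')"
  unfolding reduces_poly_def coeff_mult by (auto intro!: reduces_sum reduces_mult)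

lemma reduces_poly_1: "reduces_poly p z 1 1"
  by (auto simp: reduces_poly_def reduces_0 reduces_1)

lemma reduces_poly_prod:
  "(\<And>i. i \<in> I \<Longrightarrow> reduces_poly p z (f i) (g i)) \<Longrightarrow> reduces_poly p z (\<Prod>i\<in>I. f i) (\<Prod>i\<in>I. g i)"
  by (induction I rule: infinite_finite_induct) (auto intro: reduces_poly_1 reduces_poly_mult)

lemma reduces_poly_power: "reduces_poly p z A B \<Longrightarrow> reduces_poly p z (A ^ N) (B ^ N)"
  by (induction N) (auto intro: reduces_poly_1 reduces_poly_mult)

lemma reduces_coeff_mod:
  assumes G: "coeff G M = 1" "degree G = M" "M > 0" and red: "reduces_poly p z G (monom 1 M)"
    and j: "j < M"
  shows "reduces p z (coeff (one_plus_w ^ e mod G) j) (int (e choose j))"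
  using j
proof (induction e arbitrary: j)
  case 0
  have "(1 :: complex poly) mod G = 1" using G by (intro mod_poly_less) simp
  thus ?case by (cases j) (auto simp: reduces_0 reduces_1)
next
  case (Suc e)
  define h where "h = one_plus_w ^ e mod G"
  define h' where "h' = one_plus_w * h - smult (coeff h (M - 1)) G"
  have "G \<noteq> 0" using G by auto
  hence degh: "degree h < M"
    using degree_mod_less'[of G "one_plus_w ^ e"] G unfolding h_def
    by (cases "one_plus_w ^ e mod G = 0") auto
  have w: "one_plus_w * h = h + pCons 0 h" by (simp add: one_plus_w_def)
  have ch': "coeff h' i = coeff h i + coeff (pCons 0 h) i - coeff h (M - 1) * coeff G i" for i
    by (simp add: h'_def w)
  have "degree h' < M"
  proof (rule degree_lessI)
    show "h' \<noteq> 0 \<or> 0 < M" using G by simp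
    show "\<forall>i\<ge>M. coeff h' i = 0"
    proof (intro allI impI)
      fix i assume i: "i \<ge> M"
      show "coeff h' i = 0"
      proof (cases "i = M")
        case True
        thus ?thesis using G degh by (cases M) (auto simp: ch' coeff_eq_0)
      next
        case False
        then obtain i' where "i = Suc i'" "i' \<ge> M" using i by (cases i) auto
        thus ?thesis using G degh by (auto simp: ch' coeff_eq_0)
      qed
    qed
  qed
  hence "h' = h' mod G" using G by (simp add: mod_poly_less)
  also have "\<dots> = (one_plus_w * h) mod G" by (simp add: h'_def poly_mod_diff_left mod_smult_left)
  also have "\<dots> = one_plus_w ^ Suc e mod G" by (simp add: h_def mod_mult_right_eq)
  finally have eq: "one_plus_w ^ Suc e mod G = h'" by simp
  have hred: "reduces p z (coeff h i) (int (e choose i))" if "i < M" for i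
    unfolding h_def using Suc.IH that by blast
  have "reduces p z (coeff (pCons 0 h) j) (int (Suc e choose j) - int (e choose j))"
  proof (cases j)
    case (Suc j')
    thus ?thesis using hred[of j'] Suc.prems by simp
  qed (simp add: reduces_0)
  moreover have "reduces p z (coeff h (M - 1) * coeff G j) (int (e choose (M - 1)) * 0)"
  proof (rule reduces_mult)
    show "reduces p z (coeff h (M - 1)) (int (e choose (M - 1)))" using hred G by simp
    show "reduces p z (coeff G j) 0"
      using red Suc.prems unfolding reduces_poly_def by (metis coeff_monom less_irrefl)
  qed
  ultimately have "reduces p z (coeff h' j)
    (int (e choose j) + (int (Suc e choose j) - int (e choose j)) - int (e choose (M - 1)) * 0)"
    unfolding ch' using hred Suc.prems by (intro reduces_diff reduces_add) auto
  thus ?case by (simp only: eq) simp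
qed

definition monomial :: "nat \<Rightarrow> (nat \<Rightarrow> nat) \<Rightarrow> (nat \<Rightarrow> nat) \<Rightarrow> complex" where
  "monomial n \<alpha> v = (\<Prod>i<n. of_nat (v i) ^ \<alpha> i)"

lemma sum_mono_falling_eq_0:
  fixes g :: "(nat \<Rightarrow> nat) \<Rightarrow> complex"
  assumes jets: "\<And>\<alpha>. (\<Sum>i<n. \<alpha> i) < N \<Longrightarrow> (\<Sum>v\<in>V. g v * monomial n \<alpha> v) = 0"
    and "(\<Sum>i<n. \<alpha> i) + j < N"
  shows "(\<Sum>v\<in>V. g v * monomial n \<alpha> v * (\<Prod>l<j. of_nat (dotp n u v) - of_nat l)) = 0"
  using assms(2)
proof (induction j arbitrary: \<alpha>)
  case 0
  thus ?case using jets by simp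
next
  case (Suc j)
  define ff where "ff = (\<lambda>v. \<Prod>l<j. of_nat (dotp n u v) - of_nat l :: complex)"
  have monomial: "monomial n \<alpha> v * of_nat (v i) = monomial n (\<alpha>(i := Suc (\<alpha> i))) v" if "i < n" for v i
  proof -
    have "monomial n (\<alpha>(i := Suc (\<alpha> i))) v
      = of_nat (v i) ^ Suc (\<alpha> i) * (\<Prod>l\<in>{..<n} - {i}. of_nat (v l) ^ \<alpha> l)"
      unfolding monomial_def using that by (subst prod.remove[of _ i]) (auto intro!: prod.cong)
    moreover have "monomial n \<alpha> v = of_nat (v i) ^ \<alpha> i * (\<Prod>l\<in>{..<n} - {i}. of_nat (v l) ^ \<alpha> l)"
      unfolding monomial_def using that by (subst prod.remove[of _ i]) auto
    ultimately show ?thesis by simp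
  qed
  have deg: "(\<Sum>l<n. (\<alpha>(i := Suc (\<alpha> i))) l) = Suc (\<Sum>l<n. \<alpha> l)" if "i < n" for i
  proof -
    have "(\<Sum>l<n. (\<alpha>(i := Suc (\<alpha> i))) l) = Suc (\<alpha> i) + (\<Sum>l\<in>{..<n} - {i}. \<alpha> l)"
      using that by (subst sum.remove[of _ i]) (auto intro!: sum.cong)
    moreover have "(\<Sum>l<n. \<alpha> l) = \<alpha> i + (\<Sum>l\<in>{..<n} - {i}. \<alpha> l)"
      using that by (subst sum.remove[of _ i]) auto
    ultimately show ?thesis by simp
  qed
  have up: "(\<Sum>v\<in>V. g v * monomial n (\<alpha>(i := Suc (\<alpha> i))) v * ff v) = 0" if "i < n" for i
    unfolding ff_def using Suc.prems deg[OF that] by (intro Suc.IH) simp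
  have same: "(\<Sum>v\<in>V. g v * monomial n \<alpha> v * ff v) = 0"
    unfolding ff_def using Suc.prems by (intro Suc.IH) simp
  have "g v * monomial n \<alpha> v * (ff v * (of_nat (dotp n u v) - of_nat j))
    = (\<Sum>i<n. of_nat (u i) * (g v * monomial n (\<alpha>(i := Suc (\<alpha> i))) v * ff v))
      - of_nat j * (g v * monomial n \<alpha> v * ff v)" for v
  proof -
    have "g v * monomial n \<alpha> v * ff v * of_nat (dotp n u v)
      = (\<Sum>i<n. of_nat (u i) * (g v * (monomial n \<alpha> v * of_nat (v i)) * ff v))"
      by (simp add: dotp_def sum_distrib_left mult_ac)
    also have "\<dots> = (\<Sum>i<n. of_nat (u i) * (g v * monomial n (\<alpha>(i := Suc (\<alpha> i))) v * ff v))"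
      by (intro sum.cong) (simp_all add: monomial)
    finally show ?thesis by (simp add: algebra_simps)
  qed
  hence "(\<Sum>v\<in>V. g v * monomial n \<alpha> v * (ff v * (of_nat (dotp n u v) - of_nat j)))
    = (\<Sum>v\<in>V. \<Sum>i<n. of_nat (u i) * (g v * monomial n (\<alpha>(i := Suc (\<alpha> i))) v * ff v))
      - of_nat j * (\<Sum>v\<in>V. g v * monomial n \<alpha> v * ff v)"
    by (simp add: sum_subtractf sum_distrib_left)
  also have "(\<Sum>v\<in>V. \<Sum>i<n. of_nat (u i) * (g v * monomial n (\<alpha>(i := Suc (\<alpha> i))) v * ff v))
    = (\<Sum>i<n. of_nat (u i) * (\<Sum>v\<in>V. g v * monomial n (\<alpha>(i := Suc (\<alpha> i))) v * ff v))"
    by (subst sum.swap) (simp add: sum_distrib_left)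
  also have "\<dots> = 0" using up by simp
  finally show ?case using same by (simp add: ff_def)
qed

lemma sum_choose_eq_0:
  fixes g :: "(nat \<Rightarrow> nat) \<Rightarrow> complex"
  assumes "\<And>\<alpha>. (\<Sum>i<n. \<alpha> i) < N \<Longrightarrow> (\<Sum>v\<in>V. g v * monomial n \<alpha> v) = 0" and "j < N"
  shows "(\<Sum>v\<in>V. g v * of_nat (dotp n u v choose j)) = 0"
proof -
  have "(\<Sum>v\<in>V. g v * monomial n (\<lambda>_. 0) v * (\<Prod>l<j. of_nat (dotp n u v) - of_nat l)) = 0"
    using assms(1) by (rule sum_mono_falling_eq_0) (use assms(2) in auto)
  hence "(\<Sum>v\<in>V. g v * (\<Prod>l<j. of_nat (dotp n u v) - of_nat l)) / fact j = 0"
    by (simp add: monomial_def)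
  also have "(\<Sum>v\<in>V. g v * (\<Prod>l<j. of_nat (dotp n u v) - of_nat l)) / fact j
    = (\<Sum>v\<in>V. g v * of_nat (dotp n u v choose j))"
    unfolding sum_divide_distrib
    by (intro sum.cong refl) (simp add: binomial_gbinomial gbinomial_prod_rev atLeast0LessThan)
  finally show ?thesis .
qed

lemma linear_power_dvd_if_jets_vanish:
  fixes f :: "'v \<Rightarrow> complex" and e :: "'v \<Rightarrow> nat"
  assumes c: "c \<noteq> 0"
    and jets: "\<And>j. j < N \<Longrightarrow> (\<Sum>v\<in>V. f v * c ^ e v * of_nat (e v choose j)) = 0"
  shows "[:1 - c, 1:] ^ N dvd (\<Sum>v\<in>V. smult (f v) (one_plus_w ^ e v))"
proof -
  define F where "F = (\<Sum>v\<in>V. smult (f v) (one_plus_w ^ e v))"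
  define H where "H = [:c - 1, c:]"
  define H' where "H' = [:(1 - c) / c, 1 / c:]"
  have pow: "pcompose (P ^ i) Q = pcompose P Q ^ i" for P Q :: "complex poly" and i
    by (induction i) (simp_all add: pcompose_1 pcompose_mult)
  have "pcompose one_plus_w H = smult c one_plus_w"
    by (simp add: one_plus_w_def H_def pcompose_pCons)
  hence "pcompose F H = (\<Sum>v\<in>V. smult (f v * c ^ e v) (one_plus_w ^ e v))"
    by (simp add: F_def pcompose_sum pcompose_smult pow smult_power)
  hence "coeff (pcompose F H) j = 0" if "j < N" for j
    using jets[OF that] by (simp add: coeff_sum coeff_one_plus_w_power)
  hence "monom 1 N dvd pcompose F H" by (simp add: monom_1_dvd_iff')
  then obtain R where R: "pcompose F H = monom 1 N * R" by (elim dvdE)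
  have "pcompose H H' = [:0, 1:]"
    using c by (simp add: H_def H'_def pcompose_pCons field_simps)
  hence "F = pcompose (pcompose F H) H'" by (simp flip: pcompose_assoc)
  also have "\<dots> = pcompose (monom 1 N) H' * pcompose R H'" by (simp add: R pcompose_mult)
  also have "pcompose (monom 1 N) H' = H' ^ N"
    by (simp add: monom_altdef pow pcompose_pCons)
  finally have "F = H' ^ N * pcompose R H'" .
  moreover have "H' = smult (1 / c) [:1 - c, 1:]" by (simp add: H'_def)
  hence "[:1 - c, 1:] ^ N dvd H' ^ N" by (simp only: smult_power) (rule dvd_smult, rule dvd_refl)
  ultimately show ?thesis unfolding F_def by (metis dvd_mult2)
qed

lemma prod_linear_power_dvd:
  fixes F :: "'a :: idom poly"
  assumes "finite A" "inj_on a A" "\<And>x. x \<in> A \<Longrightarrow> [:- a x, 1:] ^ N dvd F"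
  shows "(\<Prod>x\<in>A. [:- a x, 1:]) ^ N dvd F"
proof (cases "F = 0")
  case False
  from assms show ?thesis
  proof (induction A rule: finite_induct)
    case (insert y A)
    have "(\<Prod>x\<in>A. [:- a x, 1:]) ^ N dvd F" using insert by auto
    then obtain R where R: "F = (\<Prod>x\<in>A. [:- a x, 1:]) ^ N * R" by (elim dvdE)
    have "poly ((\<Prod>x\<in>A. [:- a x, 1:]) ^ N) (a y) \<noteq> 0"
      using insert by (auto simp: poly_prod inj_on_def)
    hence "order (a y) ((\<Prod>x\<in>A. [:- a x, 1:]) ^ N) = 0" by (rule order_0I)
    hence "order (a y) F = order (a y) R" using False R by (simp add: order_mult)
    moreover have "[:- a y, 1:] ^ N dvd F" using insert.prems by simp
    ultimately have "[:- a y, 1:] ^ N dvd R" using False R by (auto simp: order_divides)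
    hence "(\<Prod>x\<in>A. [:- a x, 1:]) ^ N * [:- a y, 1:] ^ N dvd (\<Prod>x\<in>A. [:- a x, 1:]) ^ N * R"
      by (intro mult_dvd_mono) auto
    moreover have "(\<Prod>x\<in>insert y A. [:- a x, 1:]) ^ N = (\<Prod>x\<in>A. [:- a x, 1:]) ^ N * [:- a y, 1:] ^ N"
      by (simp only: prod.insert[OF insert.hyps(1,2)] power_mult_distrib mult.commute)
    ultimately show ?case using R by (simp only:)
  qed simp
qed simp

definition midx :: "nat \<Rightarrow> nat \<Rightarrow> (nat \<Rightarrow> nat) set" where
  "midx n N = {\<alpha> \<in> {..<n} \<rightarrow>\<^sub>E UNIV. (\<Sum>i<n. \<alpha> i) < N}"

lemma finite_midx: "finite (midx n N)"
proof (rule finite_subset)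
  show "midx n N \<subseteq> grid n N"
  proof
    fix \<alpha> assume \<alpha>: "\<alpha> \<in> midx n N"
    have "\<alpha> i < N" if "i < n" for i
    proof -
      have "\<alpha> i \<le> (\<Sum>i<n. \<alpha> i)" using that by (intro member_le_sum) auto
      thus ?thesis using \<alpha> by (simp add: midx_def)
    qed
    thus "\<alpha> \<in> grid n N" using \<alpha> by (auto simp: midx_def grid_def PiE_iff)
  qed
qed simp

definition line_poly :: "complex \<Rightarrow> nat set \<Rightarrow> complex poly" where
  "line_poly z \<Lambda> = (\<Prod>l\<in>\<Lambda>. [:- (z ^ l - 1), 1:])"

lemma line_poly_power_degree:
  "degree (line_poly z \<Lambda> ^ N) = card \<Lambda> * N" "coeff (line_poly z \<Lambda> ^ N) (card \<Lambda> * N) = 1"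
proof -
  have deg: "degree (line_poly z \<Lambda>) = card \<Lambda>"
    unfolding line_poly_def by (subst degree_prod_eq_sum_degree) auto
  have "lead_coeff (line_poly z \<Lambda>) = 1"
    unfolding line_poly_def lead_coeff_prod by simp
  hence nz: "line_poly z \<Lambda> \<noteq> 0" "lead_coeff (line_poly z \<Lambda> ^ N) = 1" by (auto simp: lead_coeff_power)
  show d: "degree (line_poly z \<Lambda> ^ N) = card \<Lambda> * N" using nz deg by (simp add: degree_power_eq)
  show "coeff (line_poly z \<Lambda> ^ N) (card \<Lambda> * N) = 1" using nz(2) by (simp only: d)
qed

lemma reduces_line_poly_power:
  "reduces_poly p z (line_poly z \<Lambda> ^ N) (monom 1 (card \<Lambda> * N))"
proof -
  have "reduces_poly p z [:- (z ^ l - 1), 1:] (monom 1 1)" for l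
    unfolding reduces_poly_def
  proof
    fix j
    have "reduces p z (1 - z ^ l) (1 - 1)" by (intro reduces_diff reduces_1 reduces_power_root)
    thus "reduces p z (coeff [:- (z ^ l - 1), 1:] j) (coeff (monom 1 1) j)"
      by (auto simp: coeff_pCons reduces_0 reduces_1 split: nat.split)
  qed
  hence "reduces_poly p z (line_poly z \<Lambda> ^ N) ((\<Prod>l\<in>\<Lambda>. monom 1 1) ^ N)"
    unfolding line_poly_def by (intro reduces_poly_power reduces_poly_prod)
  thus ?thesis by (simp add: monom_altdef flip: power_mult)
qed

lemma card_indep_rows_le:
  fixes S :: "(nat \<Rightarrow> nat) set" and J :: "((nat \<Rightarrow> nat) \<times> nat) set"
  assumes p: "prime p" and k: "k \<ge> 1" and fin: "finite S" "finite J" "finite V"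
    and indep: "indep_mod p V (\<lambda>r v. int (dotp n (fst r) v choose snd r)) J"
    and snd_less: "\<And>r. r \<in> J \<Longrightarrow> snd r < m * N"
    and lines: "\<And>r. r \<in> J \<Longrightarrow> \<exists>a \<Lambda>. \<Lambda> \<subseteq> {..<p ^ k} \<and> card \<Lambda> = m \<and>
        (\<forall>l\<in>\<Lambda>. \<exists>s\<in>S. \<forall>i<n. [s i = a i + l * fst r i] (mod p ^ k))"
  shows "card J \<le> card S * card (midx n N)"
proof (rule ccontr)
  define q where "q = p ^ k"
  define z where "z = root_unity q"
  have q0: "q > 0" using p prime_gt_0_nat by (simp add: q_def)
  obtain a \<Lambda> where \<Lambda>: "\<And>r. r \<in> J \<Longrightarrow> \<Lambda> r \<subseteq> {..<q}" "\<And>r. r \<in> J \<Longrightarrow> card (\<Lambda> r) = m"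
    and pts: "\<And>r l. r \<in> J \<Longrightarrow> l \<in> \<Lambda> r \<Longrightarrow> \<exists>s\<in>S. \<forall>i<n. [s i = a r i + l * fst r i] (mod q)"
    using lines unfolding q_def by metis
  define I where "I = S \<times> midx n N"
  define \<phi> where "\<phi> = (\<lambda>i v. z ^ dotp n (fst i) v * monomial n (snd i) v)"
  define c where "c = (\<lambda>r v. z ^ dotp n (a r) v *
    coeff (one_plus_w ^ dotp n (fst r) v mod line_poly z (\<Lambda> r) ^ N) (snd r))"
  have finI: "finite I" using fin finite_midx by (simp add: I_def)
  have red: "reduces p z (c r v) (int (dotp n (fst r) v choose snd r))" if r: "r \<in> J" for r v
  proof -
    have "reduces p z (c r v) (1 * int (dotp n (fst r) v choose snd r))"
      unfolding c_def
    proof (intro reduces_mult reduces_power_root)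
      show "reduces p z (coeff (one_plus_w ^ dotp n (fst r) v mod line_poly z (\<Lambda> r) ^ N) (snd r))
        (int (dotp n (fst r) v choose snd r))"
      proof (rule reduces_coeff_mod)
        show "degree (line_poly z (\<Lambda> r) ^ N) = m * N" "coeff (line_poly z (\<Lambda> r) ^ N) (m * N) = 1"
          using line_poly_power_degree[of z "\<Lambda> r" N] by (simp_all only: \<Lambda>(2)[OF r])
        show "reduces_poly p z (line_poly z (\<Lambda> r) ^ N) (monom 1 (m * N))"
          using reduces_line_poly_power[of p z "\<Lambda> r" N] by (simp only: \<Lambda>(2)[OF r])
        show "snd r < m * N" "m * N > 0" using snd_less[OF r] by linarith+
      qed
    qed
    thus ?thesis by simp
  qed
  have "\<forall>r\<in>J. \<exists>\<beta>. \<forall>v\<in>V. c r v = (\<Sum>i\<in>I. \<beta> i * \<phi> i v)"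
  proof (intro ballI functional_in_span_if_kernel_le[OF finI _ fin(3)])
    fix r f assume r: "r \<in> J" and ker: "\<And>i. i \<in> I \<Longrightarrow> (\<Sum>v\<in>V. f v * \<phi> i v) = 0"
    define u where "u = fst r"
    define G where "G = line_poly z (\<Lambda> r) ^ N"
    define F where "F = (\<Sum>v\<in>V. smult (f v * z ^ dotp n (a r) v) (one_plus_w ^ dotp n u v))"
    have "[:- (z ^ l - 1), 1:] ^ N dvd F" if l: "l \<in> \<Lambda> r" for l
    proof -
      obtain s where s: "s \<in> S" "\<And>i. i < n \<Longrightarrow> [s i = a r i + l * u i] (mod q)"
        using pts[OF r l] by (auto simp: u_def)
      have char: "z ^ dotp n s v = z ^ dotp n (a r) v * (z ^ l) ^ dotp n u v" for v
      proof -
        have "[dotp n s v = (\<Sum>i<n. (a r i + l * u i) * v i)] (mod q)"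
          unfolding dotp_def using s(2) by (intro cong_sum cong_mult) auto
        also have "(\<Sum>i<n. (a r i + l * u i) * v i) = dotp n (a r) v + l * dotp n u v"
          by (simp add: dotp_def algebra_simps sum.distrib sum_distrib_left)
        finally have "z ^ dotp n s v = z ^ (dotp n (a r) v + l * dotp n u v)"
          unfolding z_def by (intro root_unity_power_cong q0)
        thus ?thesis by (simp add: power_add power_mult)
      qed
      have jets: "(\<Sum>v\<in>V. (f v * z ^ dotp n s v) * monomial n \<alpha> v) = 0" if "(\<Sum>i<n. \<alpha> i) < N" for \<alpha>
      proof -
        define \<alpha>' where "\<alpha>' = restrict \<alpha> {..<n}"
        have "\<alpha>' \<in> midx n N" using that by (simp add: midx_def \<alpha>'_def)
        moreover have "monomial n \<alpha>' v = monomial n \<alpha> v" for v by (simp add: monomial_def \<alpha>'_def)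
        ultimately show ?thesis using ker[of "(s, \<alpha>')"] s by (simp add: I_def \<phi>_def mult.assoc)
      qed
      have "[:1 - z ^ l, 1:] ^ N dvd F" unfolding F_def
      proof (rule linear_power_dvd_if_jets_vanish)
        show "z ^ l \<noteq> 0" by (simp add: z_def)
        fix j assume "j < N"
        from sum_choose_eq_0[OF jets this, of u]
        show "(\<Sum>v\<in>V. f v * z ^ dotp n (a r) v * (z ^ l) ^ dotp n u v * of_nat (dotp n u v choose j)) = 0"
          by (simp add: char mult.assoc)
      qed
      thus ?thesis by simp
    qed
    moreover have "inj_on (\<lambda>l. z ^ l - 1) (\<Lambda> r)"
    proof (rule inj_onI)
      fix l l' assume "l \<in> \<Lambda> r" "l' \<in> \<Lambda> r" and eq: "z ^ l - 1 = z ^ l' - 1"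
      hence "l < q" "l' < q" using \<Lambda>(1)[OF r] by auto
      moreover have "z ^ l = z ^ l'" using eq by simp
      ultimately show "l = l'" unfolding z_def by (intro root_unity_power_inj[OF q0])
    qed
    moreover have "finite (\<Lambda> r)" using \<Lambda>(1)[OF r] by (rule finite_subset) simp
    ultimately have "G dvd F" unfolding G_def line_poly_def by (intro prod_linear_power_dvd)
    hence "F mod G = 0" by simp
    moreover have "F mod G = (\<Sum>v\<in>V. smult (f v * z ^ dotp n (a r) v) (one_plus_w ^ dotp n u v mod G))"
      unfolding F_def using fin(3)
      by (induction V rule: finite_induct) (simp_all add: poly_mod_add_left mod_smult_left)
    ultimately have "coeff (\<Sum>v\<in>V. smult (f v * z ^ dotp n (a r) v) (one_plus_w ^ dotp n u v mod G)) (snd r) = 0"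
      by simp
    thus "(\<Sum>v\<in>V. f v * c r v) = 0" by (simp add: coeff_sum c_def G_def u_def mult.assoc)
  qed
  from bchoice[OF this] obtain \<beta>
    where \<beta>: "\<forall>r\<in>J. \<forall>v\<in>V. c r v = (\<Sum>i\<in>I. \<beta> r i * \<phi> i v)" by blast
  assume "\<not> ?thesis"
  hence "card I < card J" by (simp add: I_def card_cartesian_product)
  from underdetermined_system[OF finI fin(2) this, of \<beta>]
  obtain \<mu> where \<mu>: "\<exists>r\<in>J. \<mu> r \<noteq> 0" "\<And>i. i \<in> I \<Longrightarrow> (\<Sum>r\<in>J. \<mu> r * \<beta> r i) = 0" by blast
  have "(\<Sum>r\<in>J. \<mu> r * c r v) = 0" if v: "v \<in> V" for v
  proof -
    have "(\<Sum>r\<in>J. \<mu> r * c r v) = (\<Sum>r\<in>J. \<Sum>i\<in>I. (\<mu> r * \<beta> r i) * \<phi> i v)"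
      using \<beta> v by (simp add: sum_distrib_left mult.assoc)
    also have "\<dots> = (\<Sum>i\<in>I. (\<Sum>r\<in>J. \<mu> r * \<beta> r i) * \<phi> i v)"
      by (subst sum.swap) (simp add: sum_distrib_right)
    finally show ?thesis using \<mu>(2) by simp
  qed
  moreover have "int p dvd a" if "reduces p z 0 a" for a
    using that unfolding z_def q_def by (rule reduces_0_imp_dvd[OF p k])
  ultimately have "\<forall>r\<in>J. \<mu> r = 0"
    using reduces_mult reduces_diff red indep
    by (intro independent_if_indep_mod[OF _ _ _ p fin(2), of "reduces p z"])
  thus False using \<mu>(1) by blast
qed

section \<open>Counting\<close>

lemma midx_0_right: "midx n 0 = {}"
  by (simp add: midx_def)

lemma midx_iff: "\<alpha> \<in> midx n N \<longleftrightarrow> (\<forall>i. i \<ge> n \<longrightarrow> \<alpha> i = undefined) \<and> (\<Sum>i<n. \<alpha> i) < N"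
  by (simp add: midx_def PiE_iff extensional_def not_less)

lemma card_midx_rec: "card (midx (Suc n) (Suc K)) = card (midx n (Suc K)) + card (midx (Suc n) K)"
proof -
  define A where "A = {\<alpha> \<in> midx (Suc n) (Suc K). \<alpha> n = 0}"
  define B where "B = {\<alpha> \<in> midx (Suc n) (Suc K). \<alpha> n \<noteq> 0}"
  have upd: "(\<Sum>i<n. (\<alpha>(n := x)) i) = (\<Sum>i<n. \<alpha> i)" for \<alpha> :: "nat \<Rightarrow> nat" and x
    by (intro sum.cong) auto
  have inA: "\<alpha> \<in> A \<longleftrightarrow> (\<forall>i. i \<ge> Suc n \<longrightarrow> \<alpha> i = undefined) \<and> \<alpha> n = 0 \<and> (\<Sum>i<n. \<alpha> i) < Suc K" for \<alpha>
    unfolding A_def midx_iff mem_Collect_eq sum.lessThan_Suc by auto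
  have inB: "\<alpha> \<in> B \<longleftrightarrow> (\<forall>i. i \<ge> Suc n \<longrightarrow> \<alpha> i = undefined) \<and> \<alpha> n \<noteq> 0 \<and> (\<Sum>i<n. \<alpha> i) + \<alpha> n < Suc K" for \<alpha>
    unfolding B_def midx_iff mem_Collect_eq sum.lessThan_Suc by auto
  have "bij_betw (\<lambda>\<alpha>. \<alpha>(n := undefined)) A (midx n (Suc K))"
  proof (rule bij_betw_byWitness[where f' = "\<lambda>\<alpha>. \<alpha>(n := 0)"])
    show "\<forall>\<alpha>\<in>A. (\<alpha>(n := undefined))(n := 0) = \<alpha>"
      by (intro ballI) (simp add: inA fun_upd_idem)
    show "\<forall>\<alpha>\<in>midx n (Suc K). (\<alpha>(n := 0))(n := undefined) = \<alpha>"
      by (intro ballI) (simp add: midx_iff fun_upd_idem)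
    show "(\<lambda>\<alpha>. \<alpha>(n := undefined)) ` A \<subseteq> midx n (Suc K)"
    proof (rule image_subsetI)
      fix \<alpha> assume "\<alpha> \<in> A"
      thus "\<alpha>(n := undefined) \<in> midx n (Suc K)" unfolding inA midx_iff upd by simp
    qed
    show "(\<lambda>\<alpha>. \<alpha>(n := 0)) ` midx n (Suc K) \<subseteq> A"
    proof (rule image_subsetI)
      fix \<alpha> assume "\<alpha> \<in> midx n (Suc K)"
      thus "\<alpha>(n := 0) \<in> A" unfolding inA midx_iff upd by simp
    qed
  qed
  hence cA: "card A = card (midx n (Suc K))" by (rule bij_betw_same_card)
  have "bij_betw (\<lambda>\<alpha>. \<alpha>(n := \<alpha> n - 1)) B (midx (Suc n) K)"
  proof (rule bij_betw_byWitness[where f' = "\<lambda>\<alpha>. \<alpha>(n := Suc (\<alpha> n))"])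
    show "\<forall>\<alpha>\<in>B. (\<alpha>(n := \<alpha> n - 1))(n := Suc ((\<alpha>(n := \<alpha> n - 1)) n)) = \<alpha>"
      by (intro ballI) (simp add: inB fun_upd_idem)
    show "\<forall>\<alpha>\<in>midx (Suc n) K. (\<alpha>(n := Suc (\<alpha> n)))(n := (\<alpha>(n := Suc (\<alpha> n))) n - 1) = \<alpha>"
      by (intro ballI) (simp add: fun_upd_idem)
    show "(\<lambda>\<alpha>. \<alpha>(n := \<alpha> n - 1)) ` B \<subseteq> midx (Suc n) K"
    proof (rule image_subsetI)
      fix \<alpha> assume "\<alpha> \<in> B"
      thus "\<alpha>(n := \<alpha> n - 1) \<in> midx (Suc n) K"
        unfolding inB midx_iff sum.lessThan_Suc upd by clarsimp arith
    qed
    show "(\<lambda>\<alpha>. \<alpha>(n := Suc (\<alpha> n))) ` midx (Suc n) K \<subseteq> B"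
    proof (rule image_subsetI)
      fix \<alpha> assume "\<alpha> \<in> midx (Suc n) K"
      thus "\<alpha>(n := Suc (\<alpha> n)) \<in> B" unfolding inB midx_iff sum.lessThan_Suc upd by simp
    qed
  qed
  hence cB: "card B = card (midx (Suc n) K)" by (rule bij_betw_same_card)
  have "midx (Suc n) (Suc K) = A \<union> B" "A \<inter> B = {}" by (auto simp: A_def B_def)
  moreover have "finite A" "finite B" using finite_midx by (simp_all add: A_def B_def)
  ultimately show "card (midx (Suc n) (Suc K)) = card (midx n (Suc K)) + card (midx (Suc n) K)"
    using cA cB by (simp add: card_Un_disjoint)
qed

lemma card_midx: "fact n * card (midx n (Suc K)) = (\<Prod>i<n. Suc K + i)"
proof (induction n arbitrary: K)
  case 0
  have "midx 0 (Suc K) = {\<lambda>_. undefined}" by (auto simp: midx_def)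
  thus ?case by simp
next
  case (Suc n)
  have step: "fact (Suc n) * card (midx (Suc n) (Suc K)) = (\<Prod>i<Suc n. Suc K + i)"
    if K: "fact (Suc n) * card (midx (Suc n) K) = (\<Prod>i<Suc n. K + i)" for K
  proof -
    have "fact (Suc n) * card (midx (Suc n) (Suc K))
      = Suc n * (fact n * card (midx n (Suc K))) + fact (Suc n) * card (midx (Suc n) K)"
      by (simp add: card_midx_rec algebra_simps)
    also have "\<dots> = Suc n * (\<Prod>i<n. Suc K + i) + (\<Prod>i<Suc n. K + i)"
      unfolding K Suc.IH ..
    also have "(\<Prod>i<Suc n. K + i) = K * (\<Prod>i<n. Suc K + i)"
      by (subst prod.lessThan_Suc_shift) simp
    also have "Suc n * (\<Prod>i<n. Suc K + i) + K * (\<Prod>i<n. Suc K + i) = (\<Prod>i<Suc n. Suc K + i)"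
      by (simp add: algebra_simps)
    finally show ?thesis .
  qed
  show ?case
  proof (induction K)
    case 0
    have "(\<Prod>i<Suc n. 0 + i) = 0" by (rule prod_zero) auto
    thus ?case by (intro step) (simp add: midx_0_right)
  qed (rule step)
qed

lemma card_midx_ge: "n \<ge> 1 \<Longrightarrow> K ^ n \<le> fact n * card (midx n K)"
proof (cases K)
  case (Suc K')
  have "(\<Prod>i<n. K) \<le> (\<Prod>i<n. Suc K' + i)" using Suc by (intro prod_mono) auto
  thus ?thesis unfolding Suc card_midx using Suc by simp
qed (simp add: power_0_left)

lemma card_midx_le: "fact n * card (midx n K) \<le> (K + n) ^ n"
proof (cases K)
  case (Suc K')
  have "(\<Prod>i<n. Suc K' + i) \<le> (\<Prod>i<n. Suc K' + n)" by (intro prod_mono) auto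
  thus ?thesis unfolding Suc card_midx by simp
qed (simp add: midx_0_right)

lemma carrier_Zmod: "carrier (Zmod q) = {0..int q - 1}"
  by (simp add: residue_ring_def)

lemma units_Zmod:
  assumes "q > 1"
  shows "Units (Zmod q) = {x. 0 < x \<and> x < int q \<and> coprime x (int q)}"
proof -
  interpret residues "int q" "Zmod q" by unfold_locales (use assms in auto)
  show ?thesis by (rule res_units_eq)
qed

lemma vecs_iff: "x \<in> vecs q n \<longleftrightarrow> x \<in> extensional {..<n} \<and> (\<forall>i<n. 0 \<le> x i \<and> x i < int q)"
  by (force simp: vecs_def carrier_Zmod PiE_iff)

lemma finite_vecs: "finite (vecs q n)"
  unfolding vecs_def by (intro finite_PiE) (auto simp: carrier_Zmod)

lemma vecs_eqI:
  assumes "x \<in> vecs q n" "y \<in> vecs q n" "\<And>i. i < n \<Longrightarrow> [x i = y i] (mod int q)"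
  shows "x = y"
proof
  fix i
  show "x i = y i"
  proof (cases "i < n")
    case True
    thus ?thesis using assms by (auto simp: vecs_iff cong_def)
  next
    case False
    thus ?thesis using assms by (auto simp: vecs_iff extensional_def)
  qed
qed

lemma vscale_cong: "i < n \<Longrightarrow> [vscale q n c u i = c * u i] (mod int q)"
  by (simp add: vscale_def residue_ring_def cong_def)

lemma vscale_vecs: "q > 0 \<Longrightarrow> vscale q n c u \<in> vecs q n"
  by (auto simp: vscale_def vecs_iff residue_ring_def)

lemma line_cong:
  assumes "x \<in> line q n a u"
  obtains c where "0 \<le> c" "\<And>i. i < n \<Longrightarrow> [x i = a i + c * u i] (mod int q)"
proof -
  obtain c where c: "c \<in> carrier (Zmod q)" "x = vadd q n a (vscale q n c u)"
    using assms by (auto simp: line_def)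
  show thesis
  proof (rule that)
    show "0 \<le> c" using c by (simp add: carrier_Zmod)
    fix i assume "i < n"
    thus "[x i = a i + c * u i] (mod int q)"
      by (simp add: c vadd_def vscale_def residue_ring_def cong_def mod_add_right_eq)
  qed
qed

lemma proj_vecs_iff:
  assumes p: "prime p" and k: "k \<ge> 1"
  shows "u \<in> proj_vecs (p ^ k) n \<longleftrightarrow> u \<in> vecs (p ^ k) n \<and> (\<exists>j<n. \<not> int p dvd u j)"
proof -
  have q: "p ^ k > 1" using one_less_power[of p k] prime_gt_1_nat[OF p] k by simp
  have pf: "prime_factors (p ^ k) = {p}" "multiplicity p (p ^ k) = k"
    using p k by (simp_all add: prime_factorization_prime_power prime_elem_multiplicity_power_distrib)
  have "u j mod int (p ^ k) \<in> Units (Zmod (p ^ k)) \<longleftrightarrow> \<not> int p dvd u j"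
    if u: "u \<in> vecs (p ^ k) n" and j: "j < n" for j
  proof -
    have r: "0 \<le> u j" "u j < int (p ^ k)" using u j by (auto simp: vecs_iff)
    have "coprime (u j) (int (p ^ k)) \<longleftrightarrow> coprime (u j) (int p)" using k by simp
    also have "\<dots> \<longleftrightarrow> \<not> int p dvd u j"
      using p prime_imp_coprime[of "int p" "u j"]
      by (metis coprime_commute coprime_absorb_left not_prime_unit prime_nat_int_transfer)
    finally have cop: "coprime (u j) (int (p ^ k)) \<longleftrightarrow> \<not> int p dvd u j" .
    have "0 < u j" if "\<not> int p dvd u j" using r that by (cases "u j = 0") auto
    moreover have "u j mod int (p ^ k) = u j" using r by (rule mod_pos_pos_trivial)
    ultimately show ?thesis using r cop unfolding units_Zmod[OF q] mem_Collect_eq by metis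
  qed
  thus ?thesis unfolding proj_vecs_def pf by (auto simp: pf)
qed

definition vnat :: "nat \<Rightarrow> (nat \<Rightarrow> int) \<Rightarrow> nat \<Rightarrow> nat" where
  "vnat n x = (\<lambda>i\<in>{..<n}. nat (x i))"

lemma vnat_int: "x \<in> vecs q n \<Longrightarrow> i < n \<Longrightarrow> int (vnat n x i) = x i"
  by (simp add: vnat_def vecs_iff)

text \<open>The vectors modulo \<open>p\<^sup>L\<close> that represent the projective point of \<^term>\<open>d\<close> modulo \<open>p\<^sup>k\<close>.\<close>

definition proj_fibre :: "nat \<Rightarrow> nat \<Rightarrow> nat \<Rightarrow> nat \<Rightarrow> (nat \<Rightarrow> int) \<Rightarrow> (nat \<Rightarrow> nat) set" where
  "proj_fibre p k L n d = {y \<in> prims p n (p ^ L).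
     \<exists>c. coprime c p \<and> (\<forall>i<n. [y i = c * vnat n d i] (mod p ^ k))}"

lemma inverse_mod_prime_power:
  assumes "coprime (c :: nat) p"
  obtains e where "[e * c = 1] (mod p ^ k)" "coprime e (p ^ k)"
proof -
  have "coprime c (p ^ k)" using assms by (simp add: coprime_power_right_iff)
  from cong_solve_coprime_nat[OF this] obtain e where e: "[c * e = 1] (mod p ^ k)" by auto
  have "coprime (c * e) (p ^ k)" using cong_imp_coprime[OF cong_sym[OF e]] by simp
  hence "coprime e (p ^ k)" by (simp only: coprime_mult_left_iff)
  moreover have "[e * c = 1] (mod p ^ k)" using e by (simp only: mult.commute)
  ultimately show thesis using that by blast
qed

lemma vnat_prims:
  assumes p: "prime p" and k: "k \<ge> 1" and kL: "k \<le> L" and d: "d \<in> proj_vecs (p ^ k) n"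
  shows "vnat n d \<in> prims p n (p ^ L)"
proof -
  have dv: "d \<in> vecs (p ^ k) n" and "\<exists>j<n. \<not> int p dvd d j"
    using d by (auto simp: proj_vecs_iff[OF p k])
  then obtain j where j: "j < n" "\<not> int p dvd d j" by blast
  have "p ^ k \<le> p ^ L" using kL prime_gt_0_nat[OF p] by (simp add: power_increasing)
  moreover have "vnat n d i < p ^ k" if "i < n" for i
    using dv that vnat_int[OF dv that] unfolding vecs_iff by (metis of_nat_less_iff)
  ultimately have "vnat n d \<in> grid n (p ^ L)"
    by (force simp: grid_def vnat_def PiE_iff)
  moreover have "\<not> p dvd vnat n d j" using j vnat_int[OF dv j(1)] by (metis int_dvd_int_iff)
  ultimately show ?thesis using j by (auto simp: prims_def)
qed

lemma ex1_direction:
  assumes p: "prime p" and k: "k \<ge> 1" and kL: "k \<le> L"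
    and D: "direction_set (p ^ k) n D" and y: "y \<in> prims p n (p ^ L)"
  shows "\<exists>!d. d \<in> D \<and> y \<in> proj_fibre p k L n d"
proof -
  let ?q = "p ^ k"
  have q: "?q > 1" using one_less_power[of p k] prime_gt_1_nat[OF p] k by simp
  define y' where "y' = (\<lambda>i\<in>{..<n}. int (y i mod ?q))"
  have y'v: "y' \<in> vecs ?q n" 
  proof -
    show ?thesis using prime_gt_0_nat[OF p] by (auto simp: vecs_iff y'_def simp del: of_nat_mod of_nat_power)
  qed
  have y'c: "[y' i = int (y i)] (mod int ?q)" if "i < n" for i
    using that by (simp add: y'_def cong_def zmod_int)
  obtain j where j: "j < n" "\<not> p dvd y j" using y by (auto simp: prims_def)
  have "p dvd ?q" using k by (simp add: dvd_power)
  hence "\<not> p dvd y j mod ?q" using j by (simp add: dvd_mod_iff)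
  hence "\<not> int p dvd y' j" using j by (simp add: y'_def del: of_nat_mod)
  hence y'p: "y' \<in> proj_vecs ?q n" using y'v j by (auto simp: proj_vecs_iff[OF p k])
  define C where "C = proj_rel ?q n `` {y'}"
  have "C \<in> proj_space ?q n" unfolding C_def proj_space_def using y'p by (rule quotientI)
  hence ex1: "\<exists>!d. d \<in> C \<inter> D" using D by (simp add: direction_set_def)
  have iff: "d \<in> C \<longleftrightarrow> y \<in> proj_fibre p k L n d" if d: "d \<in> D" for d
  proof -
    have dp: "d \<in> proj_vecs ?q n" using D d by (auto simp: direction_set_def)
    hence dv: "d \<in> vecs ?q n" by (simp add: proj_vecs_iff[OF p k])
    show ?thesis
    proof
      assume "d \<in> C"
      then obtain c where c: "c \<in> Units (Zmod ?q)" "d = vscale ?q n c y'"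
        by (auto simp: C_def proj_rel_def)
      define c' where "c' = nat c"
      have "0 < c \<and> coprime c (int ?q)" using c(1) unfolding units_Zmod[OF q] by blast
      hence c': "c = int c'" and "coprime c (int ?q)" by (auto simp: c'_def)
      hence "coprime c' p" using k by simp
      then obtain e where e: "[e * c' = 1] (mod ?q)" "coprime e ?q" by (rule inverse_mod_prime_power)
      have "[y i = e * vnat n d i] (mod ?q)" if i: "i < n" for i
      proof -
        have "[int e * d i = int e * (c * y' i)] (mod int ?q)"
          unfolding c(2) by (intro cong_mult vscale_cong i) auto
        also have "[int e * (c * y' i) = int (e * c') * int (y i)] (mod int ?q)"
          unfolding c' of_nat_mult mult.assoc by (intro cong_mult y'c i) auto
        also have "[int (e * c') * int (y i) = int 1 * int (y i)] (mod int ?q)"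
          using e(1) unfolding cong_int_iff[symmetric] by (rule cong_mult) (rule cong_refl)
        finally have "[int (e * vnat n d i) = int (y i)] (mod int ?q)"
          using vnat_int[OF dv i] by simp
        thus ?thesis by (simp only: cong_int_iff) (rule cong_sym)
      qed
      moreover have "coprime e p" using e k by simp
      ultimately show "y \<in> proj_fibre p k L n d" using y by (auto simp: proj_fibre_def)
    next
      assume "y \<in> proj_fibre p k L n d"
      then obtain c where c: "coprime c p" "\<And>i. i < n \<Longrightarrow> [y i = c * vnat n d i] (mod ?q)"
        by (auto simp: proj_fibre_def)
      obtain e where e: "[e * c = 1] (mod ?q)" "coprime e ?q" using c(1) by (rule inverse_mod_prime_power)
      define e' where "e' = int (e mod ?q)"
      have ee: "[e' = int e] (mod int ?q)" by (simp add: e'_def cong_def zmod_int)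
      have "coprime (e mod ?q) ?q" using e(2) coprime_mod_left_iff[of ?q e] q by (metis not_less0)
      hence "e' \<in> Units (Zmod ?q)"
        using q prime_gt_0_nat[OF p] by (auto simp: units_Zmod[OF q] e'_def simp del: of_nat_mod of_nat_power intro: gr0I)
      moreover have "d = vscale ?q n e' y'"
      proof (rule vecs_eqI[OF dv vscale_vecs])
        show "?q > 0" using q by linarith
        fix i assume i: "i < n"
        have "[vscale ?q n e' y' i = e' * y' i] (mod int ?q)" using i by (rule vscale_cong)
        also have "[e' * y' i = int e * int (y i)] (mod int ?q)" by (intro cong_mult ee y'c i)
        also have "[int e * int (y i) = int e * int (c * vnat n d i)] (mod int ?q)"
          using c(2)[OF i] unfolding cong_int_iff[symmetric] by (intro cong_mult cong_refl)
        also have "int e * int (c * vnat n d i) = int (e * c) * d i"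
          using vnat_int[OF dv i] by simp
        also have "[int (e * c) * d i = int 1 * d i] (mod int ?q)"
          using e(1) unfolding cong_int_iff[symmetric] by (rule cong_mult) (rule cong_refl)
        finally show "[d i = vscale ?q n e' y' i] (mod int ?q)" by (simp add: cong_sym_eq)
      qed
      ultimately show "d \<in> C" using y'p dp by (auto simp: C_def proj_rel_def)
    qed
  qed
  have "d \<in> C \<inter> D \<longleftrightarrow> d \<in> D \<and> y \<in> proj_fibre p k L n d" for d
    using iff[of d] by auto
  with ex1 show ?thesis by (simp only:)
qed

lemma card_fib_le:
  assumes p: "prime p" and k: "k \<ge> 1" and kL: "k \<le> L"
    and d: "d \<in> proj_vecs (p ^ k) n" and d': "d' \<in> proj_vecs (p ^ k) n"
  shows "card (proj_fibre p k L n d) \<le> card (proj_fibre p k L n d')"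
proof -
  have L: "L \<ge> 1" using k kL by simp
  have q: "p ^ L > 1" using one_less_power[of p L] prime_gt_1_nat[OF p] L by simp
  have dvd: "p ^ k dvd p ^ L" using kL by (rule le_imp_power_dvd)
  obtain A where A: "A \<in> gl n (p ^ L)" "A (vnat n d) = vnat n d'"
    using gl_transitive_prims[OF p L vnat_prims[OF p k kL d] vnat_prims[OF p k kL d']] .
  have "A ` proj_fibre p k L n d \<subseteq> proj_fibre p k L n d'"
  proof (rule image_subsetI)
    fix y assume y: "y \<in> proj_fibre p k L n d"
    then obtain c where c: "coprime c p" "\<And>i. i < n \<Longrightarrow> [y i = c * vnat n d i] (mod p ^ k)"
      by (auto simp: proj_fibre_def)
    have "y \<in> grid n (p ^ L)" "vnat n d \<in> grid n (p ^ L)"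
      using y vnat_prims[OF p k kL d] by (auto simp: proj_fibre_def prims_def)
    from gl_cong[OF A(1) q dvd this c(2)]
    have "[A y i = c * vnat n d' i] (mod p ^ k)" if "i < n" for i using that by (simp add: A(2))
    moreover have "A y \<in> prims p n (p ^ L)"
      using gl_prims[OF p L A(1)] y by (simp add: proj_fibre_def)
    ultimately show "A y \<in> proj_fibre p k L n d'" using c(1) by (auto simp: proj_fibre_def)
  qed
  moreover have "inj_on A (proj_fibre p k L n d)"
    using A(1) permutes_inj by (auto simp: gl_def intro: inj_on_subset)
  moreover have "finite (proj_fibre p k L n d')" by (simp add: proj_fibre_def prims_def)
  ultimately show ?thesis by (intro card_inj_on_le)
qed

lemma coeff_specialize:
  "coeff (specialize n T \<delta> u) j = (\<Sum>v\<in>T. \<delta> v * int (dotp n u v choose j))"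
  by (simp add: specialize_def coeff_sum coeff_one_plus_w_power)

lemma indep_mod_gl_image:
  assumes p: "prime p" and A: "A \<in> gl n (p ^ L)"
    and J: "finite J" "\<And>r. r \<in> J \<Longrightarrow> fst r \<in> grid n (p ^ L) \<and> snd r < p ^ L"
    and indep: "indep_mod p (grid n (p ^ L)) (\<lambda>r v. int (dotp n (fst r) v choose snd r)) J"
  shows "indep_mod p (grid n (p ^ L)) (\<lambda>r v. int (dotp n (fst r) v choose snd r))
    ((\<lambda>r. (A (fst r), snd r)) ` J)"
    and "inj_on (\<lambda>r. (A (fst r), snd r)) J"
proof -
  let ?X = "grid n (p ^ L)" and ?h = "\<lambda>r. (A (fst r), snd r)"
  obtain B where B: "B permutes ?X" "adjoint_mod n (p ^ L) A B" and AX: "A permutes ?X"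
    using A by (auto simp: gl_def)
  show inj: "inj_on ?h J"
    using permutes_inj[OF AX] by (auto simp: inj_on_def prod_eq_iff)
  show "indep_mod p ?X (\<lambda>r v. int (dotp n (fst r) v choose snd r)) (?h ` J)"
    unfolding indep_mod_def
  proof (intro allI impI)
    fix l assume l: "\<forall>v\<in>?X. int p dvd (\<Sum>r\<in>?h ` J. l r * int (dotp n (fst r) v choose snd r))"
    have "int p dvd (\<Sum>r\<in>J. l (?h r) * int (dotp n (fst r) w choose snd r))" if w: "w \<in> ?X" for w
    proof -
      define v where "v = inv_into UNIV B w"
      have v: "v \<in> ?X" "B v = w"
        using w permutes_in_image[OF permutes_inv[OF B(1)]] permutes_inverses(1)[OF B(1)]
        by (auto simp: v_def)
      have "[(\<Sum>r\<in>J. l (?h r) * int (dotp n (A (fst r)) v choose snd r))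
        = (\<Sum>r\<in>J. l (?h r) * int (dotp n (fst r) w choose snd r))] (mod int p)"
      proof (intro cong_sum cong_mult cong_refl)
        fix r assume r: "r \<in> J"
        have "[dotp n (A (fst r)) v = dotp n (fst r) w] (mod p ^ L)"
          using B(2) J(2)[OF r] v unfolding adjoint_mod_def by blast
        thus "[int (dotp n (A (fst r)) v choose snd r) = int (dotp n (fst r) w choose snd r)] (mod int p)"
          using J(2)[OF r] by (intro choose_cong_prime_power[OF p]) auto
      qed
      moreover have "int p dvd (\<Sum>r\<in>J. l (?h r) * int (dotp n (A (fst r)) v choose snd r))"
        using l v(1) by (simp add: sum.reindex[OF inj])
      ultimately show ?thesis by (simp add: cong_dvd_iff)
    qed
    hence "\<forall>r\<in>J. int p dvd l (?h r)"
      using indep[unfolded indep_mod_def, rule_format, of "\<lambda>r. l (?h r)"] by blast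
    thus "\<forall>r\<in>?h ` J. int p dvd l r" by blast
  qed
qed

lemma rich_line_points:
  assumes p: "prime p" and k: "k \<ge> 1" and S: "S \<subseteq> vecs (p ^ k) n" and d: "d \<in> vecs (p ^ k) n"
    and a: "a \<in> vecs (p ^ k) n" "rich m S (line (p ^ k) n a d)" and u: "u \<in> proj_fibre p k L n d"
  shows "\<exists>a \<Lambda>. \<Lambda> \<subseteq> {..<p ^ k} \<and> card \<Lambda> = m \<and>
    (\<forall>l\<in>\<Lambda>. \<exists>s\<in>vnat n ` S. \<forall>i<n. [s i = a i + l * u i] (mod p ^ k))"
proof -
  let ?q = "p ^ k"
  obtain c where c: "coprime c p" "\<And>i. i < n \<Longrightarrow> [u i = c * vnat n d i] (mod ?q)"
    using u by (auto simp: proj_fibre_def)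
  obtain e where e: "[e * c = 1] (mod ?q)" using c(1) by (rule inverse_mod_prime_power)
  define R where "R = S \<inter> line ?q n a d"
  have "\<exists>l<?q. \<forall>i<n. [vnat n x i = vnat n a i + l * u i] (mod ?q)" if x: "x \<in> R" for x
  proof -
    have xv: "x \<in> vecs ?q n" using x S by (auto simp: R_def)
    obtain b where b: "0 \<le> b" "\<And>i. i < n \<Longrightarrow> [x i = a i + b * d i] (mod int ?q)"
      using x line_cong unfolding R_def by blast
    define l where "l = (nat b * e) mod ?q"
    have "l < ?q" using prime_gt_0_nat[OF p] by (simp add: l_def)
    moreover have "[vnat n x i = vnat n a i + l * u i] (mod ?q)" if i: "i < n" for i
    proof -
      have "[l * u i = (nat b * e) * (c * vnat n d i)] (mod ?q)"
        unfolding l_def by (intro cong_mult c(2) i) (simp add: cong_def)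
      also have "(nat b * e) * (c * vnat n d i) = nat b * vnat n d i * (e * c)" by (simp only: ac_simps)
      also have "[\<dots> = nat b * vnat n d i * 1] (mod ?q)" by (intro cong_mult e) auto
      finally have "[vnat n a i + l * u i = vnat n a i + nat b * vnat n d i] (mod ?q)"
        by (intro cong_add) auto
      moreover have "[vnat n x i = vnat n a i + nat b * vnat n d i] (mod ?q)"
      proof -
        have "[int (vnat n x i) = int (vnat n a i + nat b * vnat n d i)] (mod int ?q)"
          using b i vnat_int[OF xv i] vnat_int[OF a(1) i] vnat_int[OF d i] by simp
        thus ?thesis by (simp only: cong_int_iff)
      qed
      ultimately show ?thesis by (meson cong_sym cong_trans)
    qed
    ultimately show ?thesis by blast
  qed
  then obtain l where l: "\<And>x. x \<in> R \<Longrightarrow> l x < ?q"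
    "\<And>x i. x \<in> R \<Longrightarrow> i < n \<Longrightarrow> [vnat n x i = vnat n a i + l x * u i] (mod ?q)" by metis
  have "inj_on l R"
  proof (rule inj_onI)
    fix x y assume x: "x \<in> R" and y: "y \<in> R" and eq: "l x = l y"
    have xv: "x \<in> vecs ?q n" "y \<in> vecs ?q n" using x y S by (auto simp: R_def)
    show "x = y"
    proof (rule vecs_eqI[OF xv])
      fix i assume i: "i < n"
      have "[vnat n x i = vnat n y i] (mod ?q)"
        using l(2)[OF x i] l(2)[OF y i] unfolding eq by (meson cong_sym cong_trans)
      hence "[int (vnat n x i) = int (vnat n y i)] (mod int ?q)" by (simp only: cong_int_iff)
      thus "[x i = y i] (mod int ?q)" by (simp only: vnat_int[OF xv(1) i] vnat_int[OF xv(2) i])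
    qed
  qed
  hence "m \<le> card (l ` R)" using a(2) by (simp add: card_image rich_def R_def)
  then obtain \<Lambda> where \<Lambda>: "\<Lambda> \<subseteq> l ` R" "card \<Lambda> = m" by (meson obtain_subset_with_card_n)
  show ?thesis
  proof (intro exI conjI ballI)
    show "\<Lambda> \<subseteq> {..<?q}" using \<Lambda>(1) l(1) by auto
    show "card \<Lambda> = m" by (rule \<Lambda>(2))
    fix t assume "t \<in> \<Lambda>"
    then obtain x where x: "x \<in> R" "t = l x" using \<Lambda>(1) by auto
    thus "\<exists>s\<in>vnat n ` S. \<forall>i<n. [s i = vnat n a i + t * u i] (mod ?q)"
      using l(2)[OF x(1)] by (intro bexI[of _ "vnat n x"]) (auto simp: R_def)
  qed
qed

lemma card_prims_fib:
  assumes p: "prime p" and k: "k \<ge> 1" and kL: "k \<le> L" and n: "n \<ge> 1"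
    and D: "direction_set (p ^ k) n D"
  obtains f where "f > 0" "finite D" "D \<noteq> {}"
    "\<And>D'. D' \<subseteq> D \<Longrightarrow> card (\<Union>d\<in>D'. proj_fibre p k L n d) = card D' * f"
    "card (prims p n (p ^ L)) = card D * f"
proof -
  have p1: "p > 1" using prime_gt_1_nat[OF p] .
  have q: "p ^ L > 1" using one_less_power[of p L] p1 k kL by simp
  have D_proj: "D \<subseteq> proj_vecs (p ^ k) n" using D by (simp add: direction_set_def)
  have finD: "finite D"
    using D_proj finite_vecs[of "p ^ k" n] by (auto simp: proj_vecs_def intro: finite_subset)
  have fin: "finite (prims p n (p ^ L))" by (simp add: prims_def)
  have fib_sub: "proj_fibre p k L n d \<subseteq> prims p n (p ^ L)" for d by (auto simp: proj_fibre_def)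
  have ex1: "\<exists>!d. d \<in> D \<and> y \<in> proj_fibre p k L n d" if "y \<in> prims p n (p ^ L)" for y
    using p k kL D that by (rule ex1_direction)
  have cover: "prims p n (p ^ L) = (\<Union>d\<in>D. proj_fibre p k L n d)"
  proof (intro equalityI subsetI)
    fix y assume "y \<in> prims p n (p ^ L)"
    from ex1[OF this] show "y \<in> (\<Union>d\<in>D. proj_fibre p k L n d)" by blast
  qed (use fib_sub in blast)
  have disj: "proj_fibre p k L n d \<inter> proj_fibre p k L n d' = {}" if "d \<in> D" "d' \<in> D" "d \<noteq> d'" for d d'
  proof (rule ccontr)
    assume "proj_fibre p k L n d \<inter> proj_fibre p k L n d' \<noteq> {}"
    then obtain y where y: "y \<in> proj_fibre p k L n d" "y \<in> proj_fibre p k L n d'" by blast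
    hence "y \<in> prims p n (p ^ L)" using fib_sub by blast
    from ex1[OF this] show False using y that by blast
  qed
  have "(\<lambda>i\<in>{..<n}. 1) \<in> prims p n (p ^ L)"
    using n q p1 by (auto simp: prims_def grid_def intro!: exI[of _ 0])
  hence ne: "prims p n (p ^ L) \<noteq> {}" by blast
  then obtain d0 where d0: "d0 \<in> D" using cover by blast
  define f where "f = card (proj_fibre p k L n d0)"
  have f: "card (proj_fibre p k L n d) = f" if "d \<in> D" for d
    unfolding f_def using that d0 D_proj by (intro antisym card_fib_le[OF p k kL]) auto
  have cU: "card (\<Union>d\<in>D'. proj_fibre p k L n d) = card D' * f" if D': "D' \<subseteq> D" for D'
  proof -
    have "card (\<Union>d\<in>D'. proj_fibre p k L n d) = (\<Sum>d\<in>D'. card (proj_fibre p k L n d))"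
    proof (rule card_UN_disjoint)
      show "finite D'" using D' finD by (rule finite_subset)
      show "\<forall>d\<in>D'. finite (proj_fibre p k L n d)" using fib_sub fin finite_subset by blast
      show "\<forall>i\<in>D'. \<forall>j\<in>D'. i \<noteq> j \<longrightarrow> proj_fibre p k L n i \<inter> proj_fibre p k L n j = {}"
        using disj D' by blast
    qed
    also have "\<dots> = (\<Sum>d\<in>D'. f)" using f D' by (intro sum.cong) auto
    finally show ?thesis by simp
  qed
  have card: "card (prims p n (p ^ L)) = card D * f" using cU[of D] cover by simp
  moreover have "card (prims p n (p ^ L)) > 0" using ne fin by (simp add: card_gt_0_iff)
  ultimately have "f > 0" by (cases f) auto
  thus thesis using finD d0 cU card by (intro that[of f]) auto
qed

lemma gl_average:
  assumes p: "prime p" and L: "L \<ge> 1" and Y: "Y \<subseteq> prims p n (p ^ L)"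
    and J: "finite J" "\<And>r. r \<in> J \<Longrightarrow> f r \<in> prims p n (p ^ L)"
  shows "\<exists>A\<in>gl n (p ^ L). card J * card Y \<le> card {r\<in>J. A (f r) \<in> Y} * card (prims p n (p ^ L))"
proof -
  let ?G = "gl n (p ^ L)" and ?P = "prims p n (p ^ L)"
  have ne: "?G \<noteq> {}" using id_in_gl by blast
  have inj: "inj g" if "g \<in> ?G" for g using that permutes_inj by (auto simp: gl_def)
  have trans: "\<exists>g\<in>?G. g x = y" if "x \<in> ?P" "y \<in> ?P" for x y
    using gl_transitive_prims[OF p L that] by metis
  have stable: "g x \<in> ?P" if "g \<in> ?G" "x \<in> ?P" for g x
    using p L that by (rule gl_prims)
  have "finite ?P" by (simp add: prims_def)
  show ?thesis
  proof (rule orbit_average[where G = ?G and P = ?P and Y = Y and J = J and f = f])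
    show "g \<circ> h \<in> ?G" if "g \<in> ?G" "h \<in> ?G" for g h using that by (rule gl_comp)
    show "finite ?G" by (rule finite_gl)
    fix g assume "g \<in> ?G" "card J * card Y \<le> card {r\<in>J. g (f r) \<in> Y} * card ?P"
    thus ?thesis by blast
  qed (fact ne inj trans stable \<open>finite ?P\<close> Y J)+
qed

lemma kakeya_count:
  assumes p: "prime p" and k: "k \<ge> 1" and n: "n \<ge> 1"
    and D: "direction_set (p ^ k) n D" and S: "S \<subseteq> vecs (p ^ k) n"
    and D': "D' \<subseteq> D"
    and lines: "\<And>d. d \<in> D' \<Longrightarrow> \<exists>a\<in>vecs (p ^ k) n. rich m S (line (p ^ k) n a d)"
    and m: "m \<le> p ^ k"
    and K: "\<And>x. x < K \<Longrightarrow> (k + l) * x < m * p ^ l"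
  shows "card (midx n K) * card D' \<le> card S * card (midx n (p ^ l)) * card D"
proof -
  define L where "L = k + l"
  define X where "X = grid n (p ^ L)"
  define P where "P = prims p n (p ^ L)"
  define Y where "Y = (\<Union>d\<in>D'. proj_fibre p k L n d)"
  define M where "M = m * p ^ l"
  define b where "b = (\<lambda>(r :: (nat \<Rightarrow> nat) \<times> nat) v. int (dotp n (fst r) v choose snd r))"
  have kL: "k \<le> L" and L: "L \<ge> 1" using k by (simp_all add: L_def)
  have M_le: "M \<le> p ^ L" using m by (simp add: M_def L_def power_add)
  obtain f where f: "f > 0" "finite D" "D \<noteq> {}"
    "\<And>D'. D' \<subseteq> D \<Longrightarrow> card (\<Union>d\<in>D'. proj_fibre p k L n d) = card D' * f"
    "card (prims p n (p ^ L)) = card D * f"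
    by (rule card_prims_fib[OF p k kL n D]) blast
  have cY: "card Y = card D' * f" and cP: "card P = card D * f"
    using f(4)[OF D'] f(5) by (simp_all add: Y_def P_def)
  have finP: "finite P" by (simp add: P_def prims_def)
  have YP: "Y \<subseteq> P" by (auto simp: Y_def P_def proj_fibre_def)
  have small: "L * (\<Sum>i<n. v i) < M" if "v \<in> midx n K" for v
    using K[of "\<Sum>i<n. v i"] that by (simp add: midx_iff L_def M_def)
  have TX: "midx n K \<subseteq> X"
  proof
    fix v assume v: "v \<in> midx n K"
    have "v i < p ^ L" if "i < n" for i
    proof -
      have "v i \<le> (\<Sum>i<n. v i)" using that by (intro member_le_sum) auto
      also have "\<dots> \<le> L * (\<Sum>i<n. v i)" using L by simp
      also have "\<dots> < M" by (rule small[OF v])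
      finally show ?thesis using M_le by simp
    qed
    thus "v \<in> X" using v by (auto simp: X_def midx_def grid_def PiE_iff)
  qed
  obtain J where J: "J \<subseteq> P \<times> {..<M}" "indep_mod p X b J" "card (midx n K) \<le> card J"
  proof (rule indep_mod_large_subset[where E = "P \<times> {..<M}" and p = p and V = X and b = b and T = "midx n K"])
    show "finite (P \<times> {..<M})" using finP by simp
    show "prime p" by (rule p)
    show "finite (midx n K)" by (rule finite_midx)
    show "midx n K \<subseteq> X" by (rule TX)
    fix \<delta> v
    assume E: "\<And>e. e \<in> P \<times> {..<M} \<Longrightarrow> int p dvd (\<Sum>v\<in>midx n K. \<delta> v * b e v)" and v: "v \<in> midx n K"
    have "vanish_mod p M (specialize n (midx n K) \<delta> u)" if "u \<in> P" for u
      unfolding vanish_mod_def coeff_specialize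
    proof (intro allI impI)
      fix j assume "j < M"
      thus "int p dvd (\<Sum>v\<in>midx n K. \<delta> v * int (dotp n u v choose j))"
        using E[of "(u, j)"] that by (simp add: b_def)
    qed
    hence "vanish_mod p M (specialize n (midx n K) \<delta> u)" if "u \<in> grid n (p ^ L)" for u
      by (rule specialize_vanish_if_prims[OF p n L _ that]) (simp add: P_def)
    from specialize_vanish_imp[OF p finite_midx TX[unfolded X_def] small this v]
    show "int p dvd \<delta> v" .
  next
    fix J assume "J \<subseteq> P \<times> {..<M}" "indep_mod p X b J" "card (midx n K) \<le> card J"
    thus thesis by (rule that)
  qed
  have finJ: "finite J" using J(1) by (rule finite_subset) (use finP in simp)
  have Jd: "fst r \<in> P" "snd r < M" if "r \<in> J" for r using J(1) that by auto
  obtain A where A: "A \<in> gl n (p ^ L)" "card J * card Y \<le> card {r\<in>J. A (fst r) \<in> Y} * card P"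
    using gl_average[OF p L YP[unfolded P_def] finJ, of fst] Jd(1) unfolding P_def by blast
  define J0 where "J0 = {r\<in>J. A (fst r) \<in> Y}"
  define J1 where "J1 = (\<lambda>r. (A (fst r), snd r)) ` J0"
  have "finite J0" and indep0: "indep_mod p X b J0"
    using finJ indep_mod_subset[OF J(2) finJ, of J0] by (auto simp: J0_def)
  have range0: "fst r \<in> X \<and> snd r < p ^ L" if "r \<in> J0" for r
    using Jd[of r] that M_le by (auto simp: J0_def P_def prims_def X_def)
  note image = indep_mod_gl_image[OF p A(1) \<open>finite J0\<close> range0[unfolded X_def] indep0[unfolded X_def b_def]]
  have "card J1 = card J0" unfolding J1_def using image(2) by (rule card_image)
  have "card J1 \<le> card (vnat n ` S) * card (midx n (p ^ l))"
  proof (rule card_indep_rows_le[OF p k])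
    show "finite (vnat n ` S)" using finite_subset[OF S finite_vecs] by simp
    show "finite J1" using \<open>finite J0\<close> by (simp add: J1_def)
    show "finite X" by (simp add: X_def)
    show "indep_mod p X (\<lambda>r v. int (dotp n (fst r) v choose snd r)) J1"
      using image(1) by (simp add: J1_def X_def)
    show "snd r < m * p ^ l" if "r \<in> J1" for r
      using that Jd by (auto simp: J1_def J0_def M_def)
    show "\<exists>a \<Lambda>. \<Lambda> \<subseteq> {..<p ^ k} \<and> card \<Lambda> = m \<and>
        (\<forall>l\<in>\<Lambda>. \<exists>s\<in>vnat n ` S. \<forall>i<n. [s i = a i + l * fst r i] (mod p ^ k))" if r: "r \<in> J1" for r
    proof -
      have "fst r \<in> Y" using r by (auto simp: J1_def J0_def)
      then obtain d where d: "d \<in> D'" "fst r \<in> proj_fibre p k L n d" by (auto simp: Y_def)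
      then obtain a where a: "a \<in> vecs (p ^ k) n" "rich m S (line (p ^ k) n a d)" using lines by blast
      have "d \<in> vecs (p ^ k) n" using d(1) D' D by (auto simp: direction_set_def proj_vecs_def)
      from rich_line_points[OF p k S this a d(2)] show ?thesis .
    qed
  qed
  also have "card (vnat n ` S) \<le> card S"
    using finite_subset[OF S finite_vecs] by (rule card_image_le)
  finally have J0_le: "card J0 \<le> card S * card (midx n (p ^ l))"
    using \<open>card J1 = card J0\<close> by simp
  have "card (midx n K) * card Y \<le> card J * card Y" using J(3) by (rule mult_right_mono) simp
  also have "\<dots> \<le> card J0 * card P" using A(2) by (simp add: J0_def)
  also have "\<dots> \<le> card S * card (midx n (p ^ l)) * card P" using J0_le by (rule mult_right_mono) simp
  finally show ?thesis using f(1) by (simp add: cY cP flip: mult.assoc)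
qed

lemma card_line_le: "card (line q n a u) \<le> q"
proof -
  have "line q n a u = (\<lambda>c. vadd q n a (vscale q n c u)) ` carrier (Zmod q)"
    by (auto simp: line_def)
  also have "card \<dots> \<le> card (carrier (Zmod q))" by (intro card_image_le) (simp add: carrier_Zmod)
  also have "\<dots> = q" by (simp add: carrier_Zmod)
  finally show ?thesis .
qed

lemma finite_line: "finite (line q n a u)"
proof -
  have "line q n a u = (\<lambda>c. vadd q n a (vscale q n c u)) ` carrier (Zmod q)"
    by (auto simp: line_def)
  thus ?thesis by (simp add: carrier_Zmod)
qed

text \<open>The exponent \<^term>\<open>l\<close> sets the order of vanishing \<open>p\<^sup>l\<close> at the points of \<^term>\<open>S\<close>.\<close>

lemma kakeya_bound:
  fixes \<epsilon> :: real
  assumes p: "prime p" and k: "k \<ge> 1" and n: "n \<ge> 1" and \<epsilon>: "\<epsilon> > 0"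
    and D: "direction_set (p ^ k) n D" and kak: "kakeya (p ^ k) n D m \<epsilon> S"
  shows "\<epsilon> * (real m * real (p ^ l) / real (k + l)) ^ n \<le> real (card S) * real (p ^ l + n) ^ n"
proof -
  define D' where "D' = {u \<in> D. \<exists>a \<in> vecs (p ^ k) n. rich m S (line (p ^ k) n a u)}"
  define K where "K = (m * p ^ l + (k + l - 1)) div (k + l)"
  obtain f where "finite D" "D \<noteq> {}" by (rule card_prims_fib[OF p k order_refl n D]) blast
  hence cD: "card D > 0" by (simp add: card_gt_0_iff)
  have S: "S \<subseteq> vecs (p ^ k) n" and D': "\<epsilon> * real (card D) \<le> real (card D')"
    using kak by (simp_all add: kakeya_def D'_def)
  have "card D' > 0" using \<epsilon> cD D' by (smt (verit) mult_pos_pos of_nat_0_less_iff)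
  then obtain d where "d \<in> D'" by fastforce
  then obtain a where "rich m S (line (p ^ k) n a d)" by (auto simp: D'_def)
  hence "m \<le> card (S \<inter> line (p ^ k) n a d)" by (simp add: rich_def)
  also have "\<dots> \<le> card (line (p ^ k) n a d)" by (intro card_mono finite_line) auto
  also have "\<dots> \<le> p ^ k" by (rule card_line_le)
  finally have m: "m \<le> p ^ k" .
  have kl: "k + l > 0" using k by simp
  have Kx: "(k + l) * x < m * p ^ l" if "x < K" for x
  proof -
    have "(x + 1) * (k + l) \<le> K * (k + l)" using that by (intro mult_right_mono) auto
    also have "\<dots> \<le> m * p ^ l + (k + l - 1)" unfolding K_def by (rule div_times_less_eq_dividend)
    finally have "(x + 1) * (k + l) \<le> m * p ^ l + (k + l - 1)" .
    moreover have "z * x < y" if "(x + 1) * z \<le> y + (z - 1)" "z > 0" for z y :: nat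
      using that by (simp add: algebra_simps)
    ultimately show ?thesis using kl by blast
  qed
  have "m * p ^ l \<le> (k + l) * K"
  proof -
    have "m * p ^ l + (k + l - 1) < (k + l) * (K + 1)"
      using dividend_less_times_div[OF kl, of "m * p ^ l + (k + l - 1)"] by (simp add: K_def)
    thus ?thesis using kl by simp
  qed
  hence "real m * real (p ^ l) \<le> real (k + l) * real K"
    by (metis of_nat_le_iff of_nat_mult)
  hence K: "real m * real (p ^ l) / real (k + l) \<le> real K"
    using kl pos_divide_le_eq[of "real (k + l)"] by (simp only: of_nat_0_less_iff mult.commute)
  have "card (midx n K) * card D' \<le> card S * card (midx n (p ^ l)) * card D"
    by (rule kakeya_count[OF p k n D S _ _ m Kx]) (auto simp: D'_def)
  hence count: "real (card (midx n K)) * real (card D') \<le> real (card S) * real (card (midx n (p ^ l))) * real (card D)"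
    by (metis of_nat_le_iff of_nat_mult)
  have "(real (card (midx n K)) * \<epsilon>) * real (card D) \<le> real (card (midx n K)) * real (card D')"
    using mult_left_mono[OF D', of "real (card (midx n K))"] by (simp add: mult.assoc)
  also note count
  finally have "real (card (midx n K)) * \<epsilon> \<le> real (card S) * real (card (midx n (p ^ l)))"
    using cD by simp
  hence *: "(fact n * real (card (midx n K))) * \<epsilon> \<le> real (card S) * (fact n * real (card (midx n (p ^ l))))"
    using mult_left_mono[of _ _ "fact n :: real"] by (simp add: mult_ac)
  have "\<epsilon> * (real m * real (p ^ l) / real (k + l)) ^ n \<le> \<epsilon> * real K ^ n"
    using K \<epsilon> by (intro mult_left_mono power_mono) auto
  also have "\<dots> \<le> (fact n * real (card (midx n K))) * \<epsilon>"
  proof -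
    have "real (K ^ n) \<le> real (fact n * card (midx n K))"
      using card_midx_ge[OF n] by (rule of_nat_mono)
    thus ?thesis using \<epsilon> by (simp add: mult.commute)
  qed
  also note *
  also have "real (card S) * (fact n * real (card (midx n (p ^ l)))) \<le> real (card S) * real (p ^ l + n) ^ n"
  proof (rule mult_left_mono)
    have "real (fact n * card (midx n (p ^ l))) \<le> real ((p ^ l + n) ^ n)"
      using card_midx_le by (rule of_nat_mono)
    thus "fact n * real (card (midx n (p ^ l))) \<le> real (p ^ l + n) ^ n" by simp
  qed simp
  finally show ?thesis .
qed

theorem theorem1p8:
  fixes k n p m :: nat and \<epsilon> :: real and D S :: "(nat \<Rightarrow> int) set"
  assumes "k \<ge> 1" and "n \<ge> 1" and "prime p" and "\<epsilon> > 0"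
    and "direction_set (p ^ k) n D"
    and "kakeya (p ^ k) n D m \<epsilon> S"
  shows "real (card S) \<ge>
           \<epsilon> * (real m ^ n / (2 * (real k + real_of_int \<lceil>log (real p) (real n)\<rceil>)) ^ n) \<and>
         (p > n \<longrightarrow>
           real (card S) \<ge>
             \<epsilon> * (real m ^ n / (real k + 1) ^ n) * (1 + real n / real p) powi (- int n))"
proof -
  have p1: "p > 1" using assms(3) prime_gt_1_nat by blast
  have bound: "\<epsilon> * (real m * real (p ^ l) / real (k + l)) ^ n \<le> real (card S) * real (p ^ l + n) ^ n" for l
    by (rule kakeya_bound[OF assms(3,1,2,4,5,6)])
  have first: "\<epsilon> * (real m ^ n / (2 * (real k + real_of_int \<lceil>log (real p) (real n)\<rceil>)) ^ n) \<le> real (card S)"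
  proof -
    define l where "l = nat \<lceil>log (real p) (real n)\<rceil>"
    define N where "N = real (p ^ l)"
    have "log (real p) (real n) \<ge> 0" using p1 assms(2) by simp
    hence l: "real_of_int \<lceil>log (real p) (real n)\<rceil> = real l" by (simp add: l_def)
    have "real n = real p powr log (real p) (real n)" using p1 assms(2) by simp
    also have "\<dots> \<le> real p powr real l"
      using p1 le_of_int_ceiling[of "log (real p) (real n)"] unfolding l[symmetric]
      by (intro powr_mono) auto
    also have "\<dots> = N" using p1 by (simp add: powr_realpow N_def)
    finally have nN: "real n \<le> N" .
    have N: "N > 0" using p1 by (simp add: N_def)
    have "\<epsilon> * (real m * N / real (k + l)) ^ n \<le> real (card S) * (N + real n) ^ n"
      using bound[of l] by (simp add: N_def)
    also have "\<dots> \<le> real (card S) * (2 * N) ^ n"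
      using nN N by (intro mult_left_mono power_mono) auto
    finally have "\<epsilon> * (real m ^ n / real (k + l) ^ n) * N ^ n \<le> real (card S) * 2 ^ n * N ^ n"
      by (simp add: power_mult_distrib power_divide)
    hence "\<epsilon> * (real m ^ n / real (k + l) ^ n) \<le> real (card S) * 2 ^ n"
      by (rule mult_right_le_imp_le) (use N in simp)
    hence "\<epsilon> * (real m ^ n / real (k + l) ^ n) / 2 ^ n \<le> real (card S)"
      by (subst pos_divide_le_eq) simp_all
    thus ?thesis unfolding l power_mult_distrib by (simp add: mult.commute)
  qed
  have second: "\<epsilon> * (real m ^ n / (real k + 1) ^ n) * (1 + real n / real p) powi (- int n) \<le> real (card S)"
  proof -
    have p0: "real p > 0" using p1 by simp
    have pos: "1 + real n / real p > 0" using p0 by (simp add: add_pos_nonneg)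
    have "real p + real n = real p * (1 + real n / real p)" using p0 by (simp add: field_simps)
    hence "\<epsilon> * (real m * real p / (real k + 1)) ^ n \<le> real (card S) * (real p * (1 + real n / real p)) ^ n"
      using bound[of 1] by (simp add: add.commute)
    hence "\<epsilon> * (real m ^ n / (real k + 1) ^ n) * real p ^ n \<le> real (card S) * (1 + real n / real p) ^ n * real p ^ n"
      by (simp only: power_mult_distrib power_divide mult_ac times_divide_eq_left times_divide_eq_right)
    hence "\<epsilon> * (real m ^ n / (real k + 1) ^ n) \<le> real (card S) * (1 + real n / real p) ^ n"
      by (rule mult_right_le_imp_le) (use p0 in simp)
    hence "\<epsilon> * (real m ^ n / (real k + 1) ^ n) / (1 + real n / real p) ^ n \<le> real (card S)"
      by (simp only: pos_divide_le_eq[OF zero_less_power[OF pos]])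
    thus ?thesis by (simp add: power_int_minus divide_inverse)
  qed
  from first second show ?thesis by blast
qed

end
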